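(* Let $M$ be an odd Poisson supermanifold. The solutions of the equations $\Delta_{\boldsymbol{\rho}}e^{\sigma/2}=0$ form a groupoid, whose objects are the non-degenerate volume forms on $M$ and whose arrows $\boldsymbol{\rho}\to\boldsymbol{\rho}'$ are the factors $e^{\sigma}$ ($\sigma$ an even function) with $\boldsymbol{\rho}'=e^{\sigma}\boldsymbol{\rho}$ and $\Delta_{\boldsymbol{\rho}}e^{\sigma/2}=0$, the composition being multiplication of factors. That is, for non-degenerate volume forms $\boldsymbol{\rho}$, $\boldsymbol{\rho}'=e^{\sigma}\boldsymbol{\rho}$, $\boldsymbol{\rho}''=e^{\tau}\boldsymbol{\rho}'$ with $\sigma,\tau$ even functions: (composition) if $\Delta_{\boldsymbol{\rho}}e^{\sigma/2}=0$ and $\Delta_{\boldsymbol{\rho}'}e^{\tau/2}=0$, then $\Delta_{\boldsymbol{\rho}}e^{(\sigma+\tau)/2}=0$; (inverses) if $\Delta_{\boldsymbol{\rho}}e^{\sigma/2}=0$, then $\Delta_{\boldsymbol{\rho}'}e^{-\sigma/2}=0$.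
   Context: Setting. $M$ is a smooth supermanifold with local coordinates $x^a$ of parity $\tilde a$; tilde denotes parity; derivatives are left derivatives. An odd Poisson (Schouten) structure on $M$ is an odd function $\mathfrak{S}=\frac12\mathfrak{S}^{ab}(x)p_bp_a$ on $T^*M$, quadratic in the momenta, with $\mathfrak{S}^{ab}=(-1)^{\tilde a\tilde b}\mathfrak{S}^{ba}$ of parity $\tilde a+\tilde b+1$, satisfying $(\mathfrak{S},\mathfrak{S})=0$ for the canonical even Poisson bracket $(\ ,\ )$ on $T^*M$. The odd bracket is $\{f,g\}=(f,(\mathfrak{S},g))=-(-1)^{\tilde f(\tilde a+1)}\mathfrak{S}^{ab}\frac{\partial f}{\partial x^b}\frac{\partial g}{\partial x^a}$; the condition $(\mathfrak{S},\mathfrak{S})=0$ is equivalent to its graded Jacobi identity. A supermanifold with such a structure is an odd Poisson (= Schouten) manifold. Hamiltonian vector field: $X_f:=(-1)^{\tilde f+1}\{f,\ \}=(-1)^{\tilde a\tilde f}\mathfrak{S}^{ab}\frac{\partial f}{\partial x^b}\frac{\partial}{\partial x^a}$, of parity $\tilde f+1$. A volume form is locally $\boldsymbol{\rho}=\rho\,Dx$, where $Dx$ is the Berezin coordinate volume element (transforming by the Berezinian); non-degenerate means it is a basis element of the module of volume forms ($\rho$ even and invertible). The divergence is $\mathrm{div}_{\boldsymbol{\rho}}X=\frac1\rho(-1)^{\tilde a(\tilde X+1)}\frac{\partial(\rho X^a)}{\partial x^a}$. The odd Laplace operator on functions is $\Delta_{\boldsymbol{\rho}}f:=\mathrm{div}_{\boldsymbol{\rho}}X_f=\frac1\rho\frac{\partial}{\partial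 x^a}\left(\rho\,\mathfrak{S}^{ab}\frac{\partial f}{\partial x^b}\right)$. *)

theory Defs
  imports "HOL-Analysis.Analysis" "HOL-Library.Function_Algebras"
begin

section \<open>The Grassmann algebra\<close>

text \<open>
  An element is its family of coefficients; the coefficient at a finite set
  \<open>I = {i\<^sub>1 < \<dots> < i\<^sub>k}\<close> multiplies the monomial \<open>\<xi>\<^bsub>i\<^sub>1\<^esub> \<cdots> \<xi>\<^bsub>i\<^sub>k\<^esub>\<close>.
  The type has all generators \<open>\<xi>\<^sub>0, \<xi>\<^sub>1, \<dots>\<close>; the algebra on the first \<open>m\<close> of them is
  cut out by requiring the coefficients to live on subsets of \<open>{..<m}\<close>.
\<close>

typedef grassmann = "{u :: nat set \<Rightarrow> real. \<forall>I. infinite I \<longrightarrow> u I = 0}"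
  morphisms gcoeff Abs_grassmann
  by (rule exI[of _ "\<lambda>_. 0"]) simp

setup_lifting type_definition_grassmann

text \<open>\<open>\<xi>\<^sub>J \<xi>\<^sub>K = gsign J K \<cdot> \<xi>\<^bsub>J \<union> K\<^esub>\<close> for disjoint finite \<open>J\<close>, \<open>K\<close>.\<close>

definition gsign :: "nat set \<Rightarrow> nat set \<Rightarrow> real" where
  "gsign J K = (-1) ^ card {(j, k). j \<in> J \<and> k \<in> K \<and> k < j}"

lemma finite_inversions:
  "finite J \<Longrightarrow> finite K \<Longrightarrow> finite {(j, k). j \<in> J \<and> k \<in> K \<and> k < (j::nat)}"
  by (rule finite_subset[of _ "J \<times> K"]) auto

lemma gsign_empty [simp]: "gsign {} K = 1" "gsign J {} = 1"
  by (simp_all add: gsign_def)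

lemma gsign_Un_left:
  assumes "finite J" "finite K" "finite L" "J \<inter> K = {}"
  shows "gsign (J \<union> K) L = gsign J L * gsign K L"
proof -
  have "{(j, k). j \<in> J \<union> K \<and> k \<in> L \<and> k < j}
      = {(j, k). j \<in> J \<and> k \<in> L \<and> k < j} \<union> {(j, k). j \<in> K \<and> k \<in> L \<and> k < j}" by auto
  moreover have "{(j, k). j \<in> J \<and> k \<in> L \<and> k < j} \<inter> {(j, k). j \<in> K \<and> k \<in> L \<and> k < j} = {}"
    using assms(4) by auto
  ultimately show ?thesis
    using assms finite_inversions by (simp add: gsign_def card_Un_disjoint power_add)
qed

lemma gsign_Un_right:
  assumes "finite J" "finite K" "finite L" "K \<inter> L = {}"
  shows "gsign J (K \<union> L) = gsign J K * gsign J L"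
proof -
  have "{(j, k). j \<in> J \<and> k \<in> K \<union> L \<and> k < j}
      = {(j, k). j \<in> J \<and> k \<in> K \<and> k < j} \<union> {(j, k). j \<in> J \<and> k \<in> L \<and> k < j}" by auto
  moreover have "{(j, k). j \<in> J \<and> k \<in> K \<and> k < j} \<inter> {(j, k). j \<in> J \<and> k \<in> L \<and> k < j} = {}"
    using assms(4) by auto
  ultimately show ?thesis
    using assms finite_inversions by (simp add: gsign_def card_Un_disjoint power_add)
qed

lemma gsign_cocycle:
  assumes "finite I" "J \<subseteq> I" "L \<subseteq> I - J"
  shows "gsign J (I - J) * gsign L (I - J - L) = gsign (J \<union> L) (I - (J \<union> L)) * gsign J L"
proof -
  define R where "R = I - J - L"
  have fin: "finite J" "finite L" "finite R"
    using assms by (auto simp: R_def intro: finite_subset)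
  have "I - J = L \<union> R" "I - (J \<union> L) = R" "L \<union> R - L = R" "L \<inter> R = {}" "J \<inter> L = {}"
    using assms by (auto simp: R_def)
  then show ?thesis
    using fin by (simp add: gsign_Un_left gsign_Un_right)
qed

instantiation grassmann :: real_algebra_1
begin

lift_definition zero_grassmann :: grassmann is "\<lambda>I. 0" by simp
lift_definition one_grassmann :: grassmann is "\<lambda>I. if I = {} then 1 else 0" by auto
lift_definition plus_grassmann :: "grassmann \<Rightarrow> grassmann \<Rightarrow> grassmann"
  is "\<lambda>u v I. u I + v I" by simp
lift_definition minus_grassmann :: "grassmann \<Rightarrow> grassmann \<Rightarrow> grassmann"
  is "\<lambda>u v I. u I - v I" by simp
lift_definition uminus_grassmann :: "grassmann \<Rightarrow> grassmann" is "\<lambda>u I. - u I" by simp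
lift_definition scaleR_grassmann :: "real \<Rightarrow> grassmann \<Rightarrow> grassmann" is "\<lambda>r u I. r * u I" by simp
lift_definition times_grassmann :: "grassmann \<Rightarrow> grassmann \<Rightarrow> grassmann"
  is "\<lambda>u v I. \<Sum>J\<in>Pow I. gsign J (I - J) * u J * v (I - J)"
  by (simp add: finite_Pow_iff)

instance
proof
  fix a b c :: grassmann and r s :: real
  show "a + b + c = a + (b + c)" by transfer (auto simp: fun_eq_iff)
  show "a + b = b + a" by transfer (auto simp: fun_eq_iff)
  show "0 + a = a" by transfer (auto simp: fun_eq_iff)
  show "- a + a = 0" by transfer (auto simp: fun_eq_iff)
  show "a - b = a + - b" by transfer (auto simp: fun_eq_iff)
  show "r *\<^sub>R (a + b) = r *\<^sub>R a + r *\<^sub>R b" by transfer (auto simp: fun_eq_iff algebra_simps)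
  show "(r + s) *\<^sub>R a = r *\<^sub>R a + s *\<^sub>R a" by transfer (auto simp: fun_eq_iff algebra_simps)
  show "r *\<^sub>R s *\<^sub>R a = (r * s) *\<^sub>R a" by transfer (auto simp: fun_eq_iff algebra_simps)
  show "1 *\<^sub>R a = a" by transfer (auto simp: fun_eq_iff)
  show "(0::grassmann) \<noteq> 1" by transfer (auto simp: fun_eq_iff)
  show "r *\<^sub>R a * b = r *\<^sub>R (a * b)"
    by transfer (auto simp: fun_eq_iff sum_distrib_left algebra_simps)
  show "a * r *\<^sub>R b = r *\<^sub>R (a * b)"
    by transfer (auto simp: fun_eq_iff sum_distrib_left algebra_simps)
  show "(a + b) * c = a * c + b * c"
    by transfer (auto simp: fun_eq_iff sum.distrib algebra_simps)
  show "a * (b + c) = a * b + a * c"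
    by transfer (auto simp: fun_eq_iff sum.distrib algebra_simps)
  show "1 * a = a"
  proof (transfer, rule ext)
    fix u :: "nat set \<Rightarrow> real" and I assume u: "\<forall>I. infinite I \<longrightarrow> u I = 0"
    show "(\<Sum>J\<in>Pow I. gsign J (I - J) * (if J = {} then 1 else 0) * u (I - J)) = u I"
    proof (cases "finite I")
      case True
      have "(\<Sum>J\<in>Pow I. gsign J (I - J) * (if J = {} then 1 else 0) * u (I - J))
          = (\<Sum>J\<in>Pow I. if J = {} then u I else 0)" by (intro sum.cong) auto
      with True show ?thesis by simp
    qed (use u in \<open>simp add: finite_Pow_iff\<close>)
  qed
  show "a * 1 = a"
  proof (transfer, rule ext)
    fix u :: "nat set \<Rightarrow> real" and I assume u: "\<forall>I. infinite I \<longrightarrow> u I = 0"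
    show "(\<Sum>J\<in>Pow I. gsign J (I - J) * u J * (if I - J = {} then 1 else 0)) = u I"
    proof (cases "finite I")
      case True
      have "(\<Sum>J\<in>Pow I. gsign J (I - J) * u J * (if I - J = {} then 1 else 0))
          = (\<Sum>J\<in>Pow I. if J = I then u I else 0)" by (intro sum.cong) auto
      with True show ?thesis by simp
    qed (use u in \<open>simp add: finite_Pow_iff\<close>)
  qed
  show "a * b * c = a * (b * c)"
  proof (transfer, rule ext)
    fix u v w :: "nat set \<Rightarrow> real" and I :: "nat set"
    show "(\<Sum>K\<in>Pow I. gsign K (I - K) * (\<Sum>J\<in>Pow K. gsign J (K - J) * u J * v (K - J)) * w (I - K))
        = (\<Sum>J\<in>Pow I. gsign J (I - J) * u J *
             (\<Sum>L\<in>Pow (I - J). gsign L (I - J - L) * v L * w (I - J - L)))"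
    proof (cases "finite I")
      case fin: True
      have "(\<Sum>K\<in>Pow I. gsign K (I - K) * (\<Sum>J\<in>Pow K. gsign J (K - J) * u J * v (K - J)) * w (I - K))
          = (\<Sum>(K, J)\<in>Sigma (Pow I) Pow.
               gsign K (I - K) * gsign J (K - J) * u J * v (K - J) * w (I - K))"
        using fin by (subst sum.Sigma[symmetric])
          (auto simp: sum_distrib_left sum_distrib_right mult_ac intro: finite_subset)
      also have "\<dots> = (\<Sum>(J, L)\<in>Sigma (Pow I) (\<lambda>J. Pow (I - J)).
               gsign J (I - J) * gsign L (I - J - L) * u J * v L * w (I - J - L))"
      proof (rule sum.reindex_bij_witness[of _ "\<lambda>(J, L). (J \<union> L, J)" "\<lambda>(K, J). (J, K - J)"])
        fix p assume "p \<in> Sigma (Pow I) Pow"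
        then obtain K J where p: "p = (K, J)" "K \<subseteq> I" "J \<subseteq> K" by auto
        have eq: "J \<union> (K - J) = K" "I - J - (K - J) = I - K" using p by auto
        have "gsign J (I - J) * gsign (K - J) (I - J - (K - J)) = gsign K (I - K) * gsign J (K - J)"
          using gsign_cocycle[of I J "K - J"] fin p eq by auto
        then show "(case case p of (K, J) \<Rightarrow> (J, K - J) of (J, L) \<Rightarrow>
              gsign J (I - J) * gsign L (I - J - L) * u J * v L * w (I - J - L))
            = (case p of (K, J) \<Rightarrow> gsign K (I - K) * gsign J (K - J) * u J * v (K - J) * w (I - K))"
          using p eq by simp
      qed auto
      also have "\<dots> = (\<Sum>J\<in>Pow I. gsign J (I - J) * u J *
             (\<Sum>L\<in>Pow (I - J). gsign L (I - J - L) * v L * w (I - J - L)))"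
        using fin by (subst sum.Sigma[symmetric])
          (auto simp: sum_distrib_left mult_ac)
      finally show ?thesis .
    qed (simp add: finite_Pow_iff)
  qed
qed

end

text \<open>\<open>inverse x\<close> is the two-sided inverse, and \<open>0\<close> if there is none.\<close>

instantiation grassmann :: inverse
begin

definition inverse_grassmann :: "grassmann \<Rightarrow> grassmann" where
  "inverse_grassmann x =
     (if \<exists>y. x * y = 1 \<and> y * x = 1 then THE y. x * y = 1 \<and> y * x = 1 else 0)"

definition divide_grassmann :: "grassmann \<Rightarrow> grassmann \<Rightarrow> grassmann" where
  "divide_grassmann x y = x * inverse y"

instance ..

end

lift_definition gen :: "nat \<Rightarrow> grassmann" is "\<lambda>i I. if I = {i} then 1 else 0" by auto

lift_definition gmake :: "(nat set \<Rightarrow> real) \<Rightarrow> grassmann" is "\<lambda>u I. if finite I then u I else 0"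
  by simp

text \<open>Homogeneous component of parity \<open>e mod 2\<close>.\<close>

lift_definition gpart :: "nat \<Rightarrow> grassmann \<Rightarrow> grassmann"
  is "\<lambda>e u I. if even (card I) = even e then u I else 0" by simp

text \<open>Left derivative with respect to \<open>\<xi>\<^sub>i\<close>: move \<open>\<xi>\<^sub>i\<close> to the front of the monomial, then drop it.\<close>

lift_definition gderiv :: "nat \<Rightarrow> grassmann \<Rightarrow> grassmann"
  is "\<lambda>i u I. if i \<in> I then 0 else gsign {i} I * u (insert i I)" by simp

definition body :: "grassmann \<Rightarrow> real" where
  "body x = gcoeff x {}"

text \<open>
  \<open>e\<^bsup>b + \<nu>\<^esup> = e\<^sup>b \<Sum>\<^sub>k \<nu>\<^sup>k / k!\<close> with \<open>b\<close> the body; the soul \<open>\<nu>\<close> is nilpotent as soon as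
  only finitely many generators occur in it, so that the sum is finite.
\<close>

definition gexp :: "grassmann \<Rightarrow> grassmann" where
  "gexp x = (let \<nu> = x - of_real (body x) in
     exp (body x) *\<^sub>R (\<Sum>k | \<nu> ^ k \<noteq> 0. (1 / fact k) *\<^sub>R \<nu> ^ k))"

definition gdet :: "nat \<Rightarrow> (nat \<Rightarrow> nat \<Rightarrow> grassmann) \<Rightarrow> grassmann" where
  "gdet k A = (\<Sum>p | p permutes {..<k}.
     of_int (sign p) * prod_list (map (\<lambda>i. A i (p i)) [0..<k]))"

definition gmat_inv :: "nat \<Rightarrow> (nat \<Rightarrow> nat \<Rightarrow> grassmann) \<Rightarrow> nat \<Rightarrow> nat \<Rightarrow> grassmann" where
  "gmat_inv k A = (THE B. (\<forall>i j. \<not> (i < k \<and> j < k) \<longrightarrow> B i j = 0) \<and>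
     (\<forall>i<k. \<forall>j<k. (\<Sum>l<k. A i l * B l j) = (if i = j then 1 else 0) \<and>
                  (\<Sum>l<k. B i l * A l j) = (if i = j then 1 else 0)))"

text \<open>
  \<open>Ber (A B; C D) = det (A - B D\<^sup>-\<^sup>1 C) \<cdot> (det D)\<^sup>-\<^sup>1\<close> for an even supermatrix of format \<open>n|m\<close>;
  the entries of \<open>A - B D\<^sup>-\<^sup>1 C\<close> and \<open>D\<close> are even, hence commute.
\<close>

definition berezinian :: "nat \<Rightarrow> nat \<Rightarrow> (nat \<Rightarrow> nat \<Rightarrow> grassmann) \<Rightarrow> grassmann" where
  "berezinian n m J = (let D = (\<lambda>i j. J (n + i) (n + j)) in
     gdet n (\<lambda>i j. J i j - (\<Sum>k<m. \<Sum>l<m. J i (n + k) * gmat_inv m D k l * J (n + l) j))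
       * inverse (gdet m D))"


section \<open>Superdomains\<close>

text \<open>
  A function on a superdomain \<open>W\<close> of dimension \<open>n|m\<close>, \<open>W\<close> open in \<^term>\<open>Euclidean_space n\<close>, is a
  map to the Grassmann algebra on \<open>m\<close> generators with smooth coefficients; that is, an element of
  \<open>C\<^sup>\<infinity>(W) \<otimes> \<Lambda>(\<xi>\<^sub>0, \<dots>, \<xi>\<^bsub>m-1\<^esub>)\<close>. It is extended by \<open>0\<close> outside \<open>W\<close>, so that equality on \<open>W\<close> is
  equality. The ring operations on functions are the pointwise ones.
\<close>

type_synonym point = "nat \<Rightarrow> real"
type_synonym superfun = "point \<Rightarrow> grassmann"

definition partial :: "nat \<Rightarrow> (point \<Rightarrow> real) \<Rightarrow> point \<Rightarrow> real" where
  "partial i g x = deriv (\<lambda>t. g (x(i := t))) (x i)"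

text \<open>Smoothness: all iterated partial derivatives exist and are continuous.\<close>

definition smooth_on :: "nat \<Rightarrow> point set \<Rightarrow> (point \<Rightarrow> real) \<Rightarrow> bool" where
  "smooth_on n W g \<longleftrightarrow> (\<forall>is. set is \<subseteq> {..<n} \<longrightarrow>
     continuous_map (subtopology (Euclidean_space n) W) euclideanreal (foldr partial is g) \<and>
     (\<forall>x\<in>W. \<forall>i<n. (\<lambda>t. foldr partial is g (x(i := t))) differentiable at (x i)))"

definition restr :: "point set \<Rightarrow> superfun \<Rightarrow> superfun" where
  "restr W f = (\<lambda>x. if x \<in> W then f x else 0)"

definition superfuns :: "nat \<Rightarrow> nat \<Rightarrow> point set \<Rightarrow> superfun set" where
  "superfuns n m W = {f. (\<forall>x. x \<notin> W \<longrightarrow> f x = 0) \<and>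
     (\<forall>x I. gcoeff (f x) I \<noteq> 0 \<longrightarrow> I \<subseteq> {..<m}) \<and>
     (\<forall>I. smooth_on n W (\<lambda>x. gcoeff (f x) I))}"

definition const_fun :: "point set \<Rightarrow> real \<Rightarrow> superfun" where
  "const_fun W r = restr W (\<lambda>x. of_real r)"

definition scale_fun :: "real \<Rightarrow> superfun \<Rightarrow> superfun" where
  "scale_fun r f = (\<lambda>x. r *\<^sub>R f x)"

definition has_parity :: "nat \<Rightarrow> superfun \<Rightarrow> bool" where
  "has_parity e f \<longleftrightarrow> (\<forall>x I. gcoeff (f x) I \<noteq> 0 \<longrightarrow> even (card I) = even e)"

definition part :: "nat \<Rightarrow> superfun \<Rightarrow> superfun" where
  "part e f = (\<lambda>x. gpart e (f x))"

text \<open>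
  Coordinates of a superdomain of dimension \<open>n|m\<close> are numbered \<open>0, \<dots>, n + m - 1\<close>, the even ones
  first. \<open>par n a\<close> is the parity of the \<open>a\<close>-th one.
\<close>

definition par :: "nat \<Rightarrow> nat \<Rightarrow> nat" where
  "par n a = (if a < n then 0 else 1)"

definition coord :: "nat \<Rightarrow> point set \<Rightarrow> nat \<Rightarrow> superfun" where
  "coord n W a = restr W (\<lambda>x. if a < n then of_real (x a) else gen (a - n))"

text \<open>Left partial derivative with respect to the \<open>a\<close>-th coordinate.\<close>

definition pd :: "nat \<Rightarrow> point set \<Rightarrow> nat \<Rightarrow> superfun \<Rightarrow> superfun" where
  "pd n W a f = restr W (\<lambda>x. if a < n then gmake (\<lambda>I. partial a (\<lambda>y. gcoeff (f y) I) x)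
                              else gderiv (a - n) (f x))"


section \<open>Supermanifolds\<close>

text \<open>
  A supermanifold of dimension \<open>n|m\<close> is given by gluing superdomains: an underlying topological
  space with charts \<open>cmap M c\<close> from open sets \<open>cdom M c\<close> onto open subsets of \<open>\<real>\<^sup>n\<close>, and, on the
  overlap of two charts, an isomorphism of sheaves of superalgebras. For an open
  \<open>W \<subseteq> cdom M c \<inter> cdom M d\<close>, \<open>trans M c d W\<close> re-expresses a function on \<open>W\<close> given in the coordinates
  of \<open>d\<close> through the coordinates of \<open>c\<close>.
\<close>

record ('p, 'c) supermfd =
  base :: "'p topology"
  edim :: nat
  odim :: nat
  charts :: "'c set"
  cdom :: "'c \<Rightarrow> 'p set"
  cmap :: "'c \<Rightarrow> 'p \<Rightarrow> point"
  trans :: "'c \<Rightarrow> 'c \<Rightarrow> 'p set \<Rightarrow> superfun \<Rightarrow> superfun"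

definition sections :: "('p, 'c) supermfd \<Rightarrow> 'c \<Rightarrow> 'p set \<Rightarrow> superfun set" where
  "sections M c W = superfuns (edim M) (odim M) (cmap M c ` W)"

definition superalgebra_hom ::
    "nat \<Rightarrow> nat \<Rightarrow> point set \<Rightarrow> point set \<Rightarrow> (superfun \<Rightarrow> superfun) \<Rightarrow> bool" where
  "superalgebra_hom n m V W T \<longleftrightarrow>
     T ` superfuns n m V \<subseteq> superfuns n m W \<and>
     (\<forall>r. T (const_fun V r) = const_fun W r) \<and>
     (\<forall>f\<in>superfuns n m V. \<forall>g\<in>superfuns n m V. T (f + g) = T f + T g \<and> T (f * g) = T f * T g) \<and>
     (\<forall>f\<in>superfuns n m V. \<forall>e. has_parity e f \<longrightarrow> has_parity e (T f))"

definition supermanifold :: "('p, 'c) supermfd \<Rightarrow> bool" where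
  "supermanifold M \<longleftrightarrow>
     Hausdorff_space (base M) \<and> second_countable (base M) \<and>
     (\<Union>c\<in>charts M. cdom M c) = topspace (base M) \<and>
     (\<forall>c\<in>charts M. openin (base M) (cdom M c) \<and>
        openin (Euclidean_space (edim M)) (cmap M c ` cdom M c) \<and>
        homeomorphic_map (subtopology (base M) (cdom M c))
          (subtopology (Euclidean_space (edim M)) (cmap M c ` cdom M c)) (cmap M c)) \<and>
     (\<forall>c\<in>charts M. \<forall>d\<in>charts M. \<forall>W. openin (base M) W \<and> W \<subseteq> cdom M c \<inter> cdom M d \<longrightarrow>
        superalgebra_hom (edim M) (odim M) (cmap M d ` W) (cmap M c ` W) (trans M c d W) \<and>
        (\<forall>f\<in>sections M d W. \<forall>p\<in>W.
           body (trans M c d W f (cmap M c p)) = body (f (cmap M d p))) \<and>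
        (\<forall>f\<in>sections M d W. \<forall>W'. openin (base M) W' \<and> W' \<subseteq> W \<longrightarrow>
           trans M c d W' (restr (cmap M d ` W') f) = restr (cmap M c ` W') (trans M c d W f))) \<and>
     (\<forall>c\<in>charts M. \<forall>W. openin (base M) W \<and> W \<subseteq> cdom M c \<longrightarrow>
        (\<forall>f\<in>sections M c W. trans M c c W f = f)) \<and>
     (\<forall>b\<in>charts M. \<forall>c\<in>charts M. \<forall>d\<in>charts M. \<forall>W.
        openin (base M) W \<and> W \<subseteq> cdom M b \<inter> cdom M c \<inter> cdom M d \<longrightarrow>
        (\<forall>f\<in>sections M d W. trans M b c W (trans M c d W f) = trans M b d W f))"

text \<open>The range of the chart \<open>c\<close>, and the image in it of the overlap with the chart \<open>d\<close>.\<close>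

definition crange :: "('p, 'c) supermfd \<Rightarrow> 'c \<Rightarrow> point set" where
  "crange M c = cmap M c ` cdom M c"

definition overlap :: "('p, 'c) supermfd \<Rightarrow> 'c \<Rightarrow> 'c \<Rightarrow> point set" where
  "overlap M c d = cmap M c ` (cdom M c \<inter> cdom M d)"

definition transfer :: "('p, 'c) supermfd \<Rightarrow> 'c \<Rightarrow> 'c \<Rightarrow> superfun \<Rightarrow> superfun" where
  "transfer M c d f = trans M c d (cdom M c \<inter> cdom M d) (restr (overlap M d c) f)"

text \<open>
  Objects on \<open>M\<close> are families of local expressions, one for each chart, subject to the appropriate
  transformation law; they are set to \<open>0\<close> at indices that are not charts.
\<close>

type_synonym 'c family = "'c \<Rightarrow> superfun"

definition chart_family :: "('p, 'c) supermfd \<Rightarrow> 'c family \<Rightarrow> bool" where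
  "chart_family M f \<longleftrightarrow> (\<forall>c\<in>charts M. f c \<in> sections M c (cdom M c)) \<and> (\<forall>c. c \<notin> charts M \<longrightarrow> f c = 0)"

definition superfunctions :: "('p, 'c) supermfd \<Rightarrow> 'c family set" where
  "superfunctions M = {f. chart_family M f \<and>
     (\<forall>c\<in>charts M. \<forall>d\<in>charts M. restr (overlap M c d) (f c) = transfer M c d (f d))}"

definition even_functions :: "('p, 'c) supermfd \<Rightarrow> 'c family set" where
  "even_functions M = {f \<in> superfunctions M. \<forall>c\<in>charts M. has_parity 0 (f c)}"

definition one_function :: "('p, 'c) supermfd \<Rightarrow> 'c family" where
  "one_function M = (\<lambda>c. if c \<in> charts M then const_fun (crange M c) 1 else 0)"

definition scale_family :: "real \<Rightarrow> 'c family \<Rightarrow> 'c family" where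
  "scale_family r f = (\<lambda>c. scale_fun r (f c))"

definition exp_function :: "('p, 'c) supermfd \<Rightarrow> 'c family \<Rightarrow> 'c family" where
  "exp_function M \<sigma> =
     (\<lambda>c. if c \<in> charts M then restr (crange M c) (\<lambda>x. gexp (\<sigma> c x)) else 0)"

text \<open>\<open>jacobian M c d a b\<close> is \<open>\<partial>y\<^sup>b / \<partial>x\<^sup>a\<close>, where \<open>x\<close>, \<open>y\<close> are the coordinates of the charts \<open>c\<close>, \<open>d\<close>;
  it is expressed in the coordinates \<open>x\<close>.\<close>

definition jacobian :: "('p, 'c) supermfd \<Rightarrow> 'c \<Rightarrow> 'c \<Rightarrow> nat \<Rightarrow> nat \<Rightarrow> superfun" where
  "jacobian M c d a b = pd (edim M) (overlap M c d) a
     (transfer M c d (coord (edim M) (crange M d) b))"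


section \<open>Volume forms\<close>

text \<open>
  The family \<open>\<rho>\<close> stands for the volume form equal to \<open>\<rho> c Dx\<close> in the chart \<open>c\<close> with coordinates \<open>x\<close>.
  The transformation law is that of \<open>Dy = Ber (\<partial>y / \<partial>x) Dx\<close>.
\<close>

definition volume_forms :: "('p, 'c) supermfd \<Rightarrow> 'c family set" where
  "volume_forms M = {\<rho>. chart_family M \<rho> \<and>
     (\<forall>c\<in>charts M. \<forall>d\<in>charts M. restr (overlap M c d) (\<rho> c) =
        transfer M c d (\<rho> d) *
        restr (overlap M c d) (\<lambda>x. berezinian (edim M) (odim M) (\<lambda>a b. jacobian M c d a b x)))}"

definition nondegenerate_volume_forms :: "('p, 'c) supermfd \<Rightarrow> 'c family set" where
  "nondegenerate_volume_forms M = {\<rho> \<in> volume_forms M. \<forall>c\<in>charts M. has_parity 0 (\<rho> c) \<and>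
     (\<exists>g\<in>sections M c (cdom M c). \<rho> c * g = const_fun (crange M c) 1)}"


section \<open>Odd Poisson structures\<close>

text \<open>
  Let \<open>W\<close> be a superdomain of dimension \<open>n|m\<close> with coordinates \<open>x\<^sup>a\<close>. Its cotangent bundle is the
  superdomain of dimension \<open>2n|2m\<close> with coordinates \<open>x\<^sup>a, p\<^sub>a\<close>, where \<open>p\<^sub>a\<close> has the parity of \<open>x\<^sup>a\<close>.
  Since even coordinates are numbered first, the order is: the even \<open>x\<^sup>a\<close>, the even \<open>p\<^sub>a\<close>, the odd
  \<open>x\<^sup>a\<close>, the odd \<open>p\<^sub>a\<close>.
\<close>

definition cot_proj :: "nat \<Rightarrow> point \<Rightarrow> point" where
  "cot_proj n z = (\<lambda>i. if i < n then z i else 0)"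

definition cot :: "nat \<Rightarrow> point set \<Rightarrow> point set" where
  "cot n W = {z \<in> topspace (Euclidean_space (2 * n)). cot_proj n z \<in> W}"

definition cot_lift :: "nat \<Rightarrow> point set \<Rightarrow> superfun \<Rightarrow> superfun" where
  "cot_lift n W f = restr (cot n W) (\<lambda>z. f (cot_proj n z))"

definition x_index :: "nat \<Rightarrow> nat \<Rightarrow> nat" where
  "x_index n a = (if a < n then a else n + a)"

definition p_index :: "nat \<Rightarrow> nat \<Rightarrow> nat \<Rightarrow> nat" where
  "p_index n m a = (if a < n then n + a else n + m + a)"

definition momentum :: "nat \<Rightarrow> nat \<Rightarrow> point set \<Rightarrow> nat \<Rightarrow> superfun" where
  "momentum n m W a = coord (2 * n) (cot n W) (p_index n m a)"

text \<open>
  The canonical even bracket, which for \<open>F\<close> of parity \<open>e\<close> is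
  \<open>(F, G) = (-1)\<^bsup>|a|(e+1)\<^esup> \<partial>F/\<partial>p\<^sub>a \<partial>G/\<partial>x\<^sup>a - (-1)\<^bsup>|a| e\<^esup> \<partial>F/\<partial>x\<^sup>a \<partial>G/\<partial>p\<^sub>a\<close> (writing \<open>|a|\<close> for the parity of \<open>x\<^sup>a\<close>),
  extended additively in \<open>F\<close>. The normalization \<open>(p\<^sub>a, x\<^sup>b) = \<delta>\<^sub>a\<^sup>b\<close> and the signs are those for which
  \<open>(f, (S, g))\<close>, \<open>S = 1/2 S\<^sup>a\<^sup>b p\<^sub>b p\<^sub>a\<close>, is the odd bracket defined below.
\<close>

definition poisson_bracket :: "nat \<Rightarrow> nat \<Rightarrow> point set \<Rightarrow> superfun \<Rightarrow> superfun \<Rightarrow> superfun" where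
  "poisson_bracket n m W F G = (let dx = (\<lambda>a. pd (2 * n) (cot n W) (x_index n a));
                                   dp = (\<lambda>a. pd (2 * n) (cot n W) (p_index n m a)) in
     (\<Sum>e<2. \<Sum>a<n + m. (-1) ^ (par n a * (e + 1)) * dp a (part e F) * dx a G
                       - (-1) ^ (par n a * e) * dx a (part e F) * dp a G))"

definition quadratic_hamiltonian ::
    "nat \<Rightarrow> nat \<Rightarrow> point set \<Rightarrow> (nat \<Rightarrow> nat \<Rightarrow> superfun) \<Rightarrow> (nat \<Rightarrow> superfun) \<Rightarrow> superfun" where
  "quadratic_hamiltonian n m W S q =
     scale_fun (1/2) (\<Sum>a<n + m. \<Sum>b<n + m. cot_lift n W (S a b) * q b * q a)"

type_synonym 'c tensor = "'c \<Rightarrow> nat \<Rightarrow> nat \<Rightarrow> superfun"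

text \<open>
  \<open>S c a b\<close> are the coefficients \<open>S\<^sup>a\<^sup>b\<close> in the chart \<open>c\<close>. The last clause says that the local
  Hamiltonians are one and the same function on the cotangent bundle of \<open>M\<close>: on an overlap, the
  Hamiltonian in the coordinates \<open>y\<close> of \<open>d\<close> becomes that in the coordinates \<open>x\<close> of \<open>c\<close> on substituting
  \<open>p'\<^sub>b = \<Sum>\<^sub>a \<partial>x\<^sup>a/\<partial>y\<^sup>b p\<^sub>a\<close> for the momenta conjugate to \<open>y\<close>.
\<close>

definition odd_poisson :: "('p, 'c) supermfd \<Rightarrow> 'c tensor \<Rightarrow> bool" where
  "odd_poisson M S \<longleftrightarrow> (let n = edim M; m = odim M in
     (\<forall>c\<in>charts M. \<forall>a<n + m. \<forall>b<n + m.
        S c a b \<in> sections M c (cdom M c) \<and>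
        has_parity (par n a + par n b + 1) (S c a b) \<and>
        S c a b = (-1) ^ (par n a * par n b) * S c b a) \<and>
     (\<forall>c\<in>charts M.
        (let H = quadratic_hamiltonian n m (crange M c) (S c) (momentum n m (crange M c))
         in poisson_bracket n m (crange M c) H H = 0)) \<and>
     (\<forall>c\<in>charts M. \<forall>d\<in>charts M. let W = overlap M c d in
        quadratic_hamiltonian n m W (\<lambda>a b. restr W (S c a b)) (momentum n m W) =
        quadratic_hamiltonian n m W (\<lambda>a b. transfer M c d (S d a b))
          (\<lambda>b. \<Sum>a<n + m. cot_lift n W (transfer M c d (jacobian M d c b a)) * momentum n m W a)))"

text \<open>
  In the chart \<open>c\<close>: \<open>{f, g} = -(-1)\<^bsup>e(|a|+1)\<^esup> S\<^sup>a\<^sup>b \<partial>\<^sub>b f \<partial>\<^sub>a g\<close> for \<open>f\<close> of parity \<open>e\<close>, extended additively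
  in \<open>f\<close>; likewise, \<open>X\<^sub>f = (-1)\<^bsup>e+1\<^esup> {f, _}\<close>.
\<close>

definition odd_bracket ::
    "('p, 'c) supermfd \<Rightarrow> 'c tensor \<Rightarrow> 'c \<Rightarrow> superfun \<Rightarrow> superfun \<Rightarrow> superfun" where
  "odd_bracket M S c f g = (let n = edim M; m = odim M; D = pd n (crange M c) in
     - (\<Sum>e<2. \<Sum>a<n + m. \<Sum>b<n + m.
          (-1) ^ (e * (par n a + 1)) * S c a b * D b (part e f) * D a g))"

type_synonym 'c vector_field = "'c \<Rightarrow> nat \<Rightarrow> superfun"

definition hamiltonian_field ::
    "('p, 'c) supermfd \<Rightarrow> 'c tensor \<Rightarrow> 'c family \<Rightarrow> 'c vector_field" where
  "hamiltonian_field M S f = (\<lambda>c a. \<Sum>e<2.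
     (-1) ^ (e + 1) * odd_bracket M S c (part e (f c)) (coord (edim M) (crange M c) a))"

text \<open>
  For a vector field \<open>X\<close> of parity \<open>e\<close>, so that \<open>X\<^sup>a\<close> has parity \<open>|a| + e\<close>, the divergence is
  \<open>\<rho>\<^sup>-\<^sup>1 (-1)\<^bsup>|a|(e+1)\<^esup> \<partial>\<^sub>a (\<rho> X\<^sup>a)\<close>; it is extended additively.
\<close>

definition divergence ::
    "('p, 'c) supermfd \<Rightarrow> 'c family \<Rightarrow> 'c vector_field \<Rightarrow> 'c family" where
  "divergence M \<rho> X = (\<lambda>c. if c \<in> charts M then let n = edim M; m = odim M in
     (\<lambda>x. inverse (\<rho> c x)) *
     (\<Sum>e<2. \<Sum>a<n + m. (-1) ^ (par n a * (e + 1)) *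
        pd n (crange M c) a (\<rho> c * part (par n a + e) (X c a))) else 0)"

definition odd_laplacian ::
    "('p, 'c) supermfd \<Rightarrow> 'c tensor \<Rightarrow> 'c family \<Rightarrow> 'c family \<Rightarrow> 'c family" where
  "odd_laplacian M S \<rho> f = divergence M \<rho> (hamiltonian_field M S f)"


section \<open>The groupoid\<close>

definition groupoid ::
    "'o set \<Rightarrow> 'a set \<Rightarrow> ('a \<Rightarrow> 'o) \<Rightarrow> ('a \<Rightarrow> 'o) \<Rightarrow> ('o \<Rightarrow> 'a) \<Rightarrow> ('a \<Rightarrow> 'a \<Rightarrow> 'a) \<Rightarrow> bool" where
  "groupoid Ob Ar src tgt idt cmp \<longleftrightarrow>
     (\<forall>f\<in>Ar. src f \<in> Ob \<and> tgt f \<in> Ob) \<and>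
     (\<forall>x\<in>Ob. idt x \<in> Ar \<and> src (idt x) = x \<and> tgt (idt x) = x) \<and>
     (\<forall>f\<in>Ar. \<forall>g\<in>Ar. tgt f = src g \<longrightarrow>
        cmp f g \<in> Ar \<and> src (cmp f g) = src f \<and> tgt (cmp f g) = tgt g) \<and>
     (\<forall>f\<in>Ar. cmp (idt (src f)) f = f \<and> cmp f (idt (tgt f)) = f) \<and>
     (\<forall>f\<in>Ar. \<forall>g\<in>Ar. \<forall>h\<in>Ar. tgt f = src g \<and> tgt g = src h \<longrightarrow>
        cmp (cmp f g) h = cmp f (cmp g h)) \<and>
     (\<forall>f\<in>Ar. \<exists>g\<in>Ar. src g = tgt f \<and> tgt g = src f \<and>
        cmp f g = idt (src f) \<and> cmp g f = idt (tgt f))"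

text \<open>An arrow is a triple (source, factor, target).\<close>

type_synonym 'c arrow = "'c family \<times> 'c family \<times> 'c family"

definition master_arrows :: "('p, 'c) supermfd \<Rightarrow> 'c tensor \<Rightarrow> 'c arrow set" where
  "master_arrows M S = {(\<rho>, exp_function M \<sigma>, \<rho>') | \<rho> \<sigma> \<rho>'.
     \<rho> \<in> nondegenerate_volume_forms M \<and> \<rho>' \<in> nondegenerate_volume_forms M \<and>
     \<sigma> \<in> even_functions M \<and> \<rho>' = exp_function M \<sigma> * \<rho> \<and>
     odd_laplacian M S \<rho> (exp_function M (scale_family (1/2) \<sigma>)) = 0}"

definition arrow_source :: "'c arrow \<Rightarrow> 'c family" where
  "arrow_source = (\<lambda>(\<rho>, g, \<rho>'). \<rho>)"

definition arrow_target :: "'c arrow \<Rightarrow> 'c family" where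
  "arrow_target = (\<lambda>(\<rho>, g, \<rho>'). \<rho>')"

definition identity_arrow :: "('p, 'c) supermfd \<Rightarrow> 'c family \<Rightarrow> 'c arrow" where
  "identity_arrow M \<rho> = (\<rho>, one_function M, \<rho>)"

definition compose_arrows :: "'c arrow \<Rightarrow> 'c arrow \<Rightarrow> 'c arrow" where
  "compose_arrows = (\<lambda>(\<rho>, g, \<rho>') (\<rho>\<^sub>1, h, \<rho>\<^sub>1'). (\<rho>, g * h, \<rho>\<^sub>1'))"

end

(*
  Put L_rho f = d_a (rho S^ab d_b f) in a chart, so that Delta_rho f vanishes iff L_rho f does.
  For even f and g the symmetry of S makes d_a g S^ab d_b f summed over a, b symmetric in f and g,
  and the Leibniz rule gives
    L_(f^2 rho) g = f (L_rho (f g) - g L_rho f).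
  With f = exp (sigma/2) and g = exp (tau/2), f^2 rho is the target of the arrow exp sigma; as f is
  invertible, composition is immediate, and inverses are the case g = 1/f since L_rho 1 = 0.
*)

theory Submission
  imports Defs
begin

section \<open>The Grassmann algebra\<close>

text \<open>The exponent 1/2 makes the gauge identity close up. Expanding L_\<rho> (f g) gives two
  cross terms, one with d f and one with d g, which symmetry makes equal; expanding L for the volume
  f^2 \<rho> gives the cross term with d f twice, once for each factor f. The two doublings match,
  so an arrow with factor e^\<sigma> calls for f = e^(\<sigma>/2). The symmetry is a sign count: d_a
  g, S^ab, d_b f have parities |a|, |a|+|b|+1, |b|, and reversing their order costs (-1)^(|a||b|),
  the sign in S^ab = (-1)^(|a||b|) S^ba. Vanishing of Delta_\<rho> f is tested chart by chart, so
  the identity is proved on one superdomain; transition laws enter through sums and negatives of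
  even functions. Two obstacles shape the rest. Functions are extended by 0 off an open set, so
  derivatives rest on locality, and the constant function 1 of a chart is not the 1 of the ring of
  all maps. And the exponential is a finite sum whose index set depends on the element, so its
  smoothness and functional equation need a common number of terms.\<close>

lemma gcoeff_infinite [simp]: "infinite I \<Longrightarrow> gcoeff u I = 0"
  using gcoeff by blast

lemma gcoeff_inject_ext: "(\<And>I. finite I \<Longrightarrow> gcoeff u I = gcoeff v I) \<Longrightarrow> u = v"
  by (metis ext gcoeff_infinite gcoeff_inject)

lemmas gcoeff_simps [simp] =
  zero_grassmann.rep_eq one_grassmann.rep_eq plus_grassmann.rep_eq minus_grassmann.rep_eq
  uminus_grassmann.rep_eq scaleR_grassmann.rep_eq gpart.rep_eq

lemmas gcoeff_mult = times_grassmann.rep_eq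

lemma gcoeff_sum: "gcoeff (sum f A) I = (\<Sum>a\<in>A. gcoeff (f a) I)"
  by (induction A rule: infinite_finite_induct) auto

lemma gcoeff_of_real: "gcoeff (of_real r) I = (if I = {} then r else 0)"
  by (simp add: of_real_def)

text \<open>A monomial of a product is a monomial of \<open>u\<close> times a disjoint monomial of
  \<open>v\<close>. Parity, support and degree bounds of products are all read off from this
  splitting.\<close>

lemma gcoeff_mult_nonzero:
  assumes "gcoeff (u * v) I \<noteq> 0"
  obtains J where "finite I" "J \<subseteq> I" "gcoeff u J \<noteq> 0" "gcoeff v (I - J) \<noteq> 0"
proof -
  have "(\<Sum>J\<in>Pow I. gsign J (I - J) * gcoeff u J * gcoeff v (I - J)) \<noteq> 0"
    using assms by (simp add: gcoeff_mult)
  then obtain J where "J \<in> Pow I" "gsign J (I - J) * gcoeff u J * gcoeff v (I - J) \<noteq> 0"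
    by (meson sum.neutral)
  moreover have "finite I" using assms gcoeff_infinite by blast
  ultimately show ?thesis using that by auto
qed

section \<open>Homogeneous elements and the sign rule\<close>

definition ghomog :: "nat \<Rightarrow> grassmann \<Rightarrow> bool" where
  "ghomog e u \<longleftrightarrow> (\<forall>I. gcoeff u I \<noteq> 0 \<longrightarrow> even (card I) = even e)"

lemma ghomog_mult:
  assumes "ghomog a u" "ghomog b v"
  shows "ghomog (a + b) (u * v)"
  unfolding ghomog_def
proof (intro allI impI)
  fix I assume "gcoeff (u * v) I \<noteq> 0"
  then obtain J where J: "finite I" "J \<subseteq> I" "gcoeff u J \<noteq> 0" "gcoeff v (I - J) \<noteq> 0"
    by (rule gcoeff_mult_nonzero)
  have "card I = card J + card (I - J)"
    using J by (metis card_mono card_Diff_subset finite_subset le_add_diff_inverse)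
  moreover have "even (card J) = even a" "even (card (I - J)) = even b"
    using J assms by (auto simp: ghomog_def)
  ultimately show "even (card I) = even (a + b)" by auto
qed

text \<open>As \<open>J\<close> and \<open>K\<close> are disjoint, each pair in
  \<open>J \<times> K\<close> is an inversion in exactly one of the two orders, so the two inversion
  counts add up to \<open>card J * card K\<close>.\<close>

lemma gsign_swap:
  assumes "finite J" "finite K" "J \<inter> K = {}"
  shows "gsign J K = (-1) ^ (card J * card K) * gsign K J"
proof -
  let ?A = "{(j, k). j \<in> J \<and> k \<in> K \<and> k < j}" and ?B = "{(k, j). k \<in> K \<and> j \<in> J \<and> j < k}"
  have B: "card ?B = card (prod.swap ` ?B)"
    by (simp add: card_image)
  have "J \<times> K = ?A \<union> prod.swap ` ?B"
    using assms(3) by (auto simp: image_iff)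
  moreover have "?A \<inter> prod.swap ` ?B = {}" by auto
  ultimately have "card J * card K = card ?A + card ?B"
    using assms(1,2) finite_inversions
    by (simp add: B card_cartesian_product[symmetric] card_Un_disjoint)
  moreover have "(-1::real) ^ k * (-1) ^ k = 1" for k by (simp flip: power_mult_distrib)
  ultimately show ?thesis
    by (simp add: gsign_def power_add mult.assoc)
qed

text \<open>In the convolution sum, passing from \<open>J\<close> to \<open>I - J\<close> exchanges
  the two factors. Where both coefficients are nonzero, the cardinalities have the parities of
  \<open>a\<close> and \<open>b\<close>, so every surviving term picks up the same sign.\<close>

lemma ghomog_commute:
  assumes "ghomog a u" "ghomog b v"
  shows "u * v = (-1) ^ (a * b) * (v * u)"
proof (rule gcoeff_inject_ext)
  fix I :: "nat set" assume I: "finite I"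
  have sgn: "gcoeff ((-1) ^ k * w) I = (-1) ^ k * gcoeff w I" for k w
    by (cases "even k") auto
  have "gcoeff (u * v) I = (\<Sum>J\<in>Pow I. gsign (I - J) (I - (I - J)) * gcoeff u (I - J) * gcoeff v (I - (I - J)))"
    unfolding gcoeff_mult
    by (rule sum.reindex_bij_witness[of _ "\<lambda>J. I - J" "\<lambda>J. I - J"]) (auto simp: double_diff)
  also have "\<dots> = (\<Sum>J\<in>Pow I. (-1) ^ (a * b) * (gsign J (I - J) * gcoeff v J * gcoeff u (I - J)))"
  proof (intro sum.cong refl)
    fix J assume "J \<in> Pow I"
    then have J: "J \<subseteq> I" "I - (I - J) = J" "finite J" using I by (auto intro: finite_subset)
    show "gsign (I - J) (I - (I - J)) * gcoeff u (I - J) * gcoeff v (I - (I - J)) =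
          (-1) ^ (a * b) * (gsign J (I - J) * gcoeff v J * gcoeff u (I - J))"
    proof (cases "gcoeff u (I - J) = 0 \<or> gcoeff v J = 0")
      case False
      then have "even (card (I - J)) = even a" "even (card J) = even b"
        using assms by (auto simp: ghomog_def)
      then have "(-1::real) ^ (card (I - J) * card J) = (-1) ^ (a * b)"
        by (simp add: uminus_power_if)
      then show ?thesis
        using gsign_swap[of "I - J" J] I J by (simp add: Int_commute)
    qed (use J in auto)
  qed
  finally show "gcoeff (u * v) I = gcoeff ((-1) ^ (a * b) * (v * u)) I"
    by (simp only: sgn gcoeff_mult[of v u] sum_distrib_left)
qed

lemma ghomog_gen: "ghomog 1 (gen i)"
  by (auto simp: ghomog_def gen.rep_eq)

text \<open>Even elements are central: any \<open>v\<close> splits into an even and an odd part, and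
  the sign exponent is 0 for both.\<close>

lemma ghomog_0_commute: "ghomog 0 u \<Longrightarrow> u * v = v * u"
proof -
  assume u: "ghomog 0 u"
  have v: "v = gpart 0 v + gpart 1 v"
    by (rule gcoeff_inject_ext) auto
  have "ghomog 0 (gpart 0 v)" "ghomog 1 (gpart 1 v)"
    by (auto simp: ghomog_def)
  then have "u * gpart 0 v = gpart 0 v * u" "u * gpart 1 v = gpart 1 v * u"
    using ghomog_commute[OF u] by fastforce+
  then show ?thesis
    by (subst (1 2) v) (simp add: distrib_left distrib_right)
qed

section \<open>The left derivative\<close>

definition gfree :: "nat \<Rightarrow> grassmann \<Rightarrow> bool" where
  "gfree i u \<longleftrightarrow> (\<forall>I. gcoeff u I \<noteq> 0 \<longrightarrow> i \<notin> I)"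

lemma gfree_mult: "gfree i u \<Longrightarrow> gfree i v \<Longrightarrow> gfree i (u * v)"
  unfolding gfree_def by (metis gcoeff_mult_nonzero Diff_iff)

lemma gfree_add: "gfree i u \<Longrightarrow> gfree i v \<Longrightarrow> gfree i (u + v)"
  unfolding gfree_def plus_grassmann.rep_eq by (metis add_0)

lemma gderiv_add: "gderiv i (u + v) = gderiv i u + gderiv i v"
  by (rule gcoeff_inject_ext) (auto simp: gderiv.rep_eq algebra_simps)

lemma gfree_gderiv: "gfree i (gderiv i u)"
  by (auto simp: gfree_def gderiv.rep_eq)

lemma gderiv_free: "gfree i u \<Longrightarrow> gderiv i u = 0"
  by (rule gcoeff_inject_ext) (auto simp: gderiv.rep_eq gfree_def)

lemma gcoeff_gen_mult:
  assumes "finite I"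
  shows "gcoeff (gen i * u) I = (if i \<in> I then gsign {i} (I - {i}) * gcoeff u (I - {i}) else 0)"
proof -
  have "gcoeff (gen i * u) I =
      (\<Sum>J\<in>Pow I. if J = {i} then gsign {i} (I - {i}) * gcoeff u (I - {i}) else 0)"
    unfolding gcoeff_mult by (intro sum.cong) (auto simp: gen.rep_eq)
  then show ?thesis using assms by simp
qed

lemma gderiv_gen_mult: "gfree i u \<Longrightarrow> gderiv i (gen i * u) = u"
proof (rule gcoeff_inject_ext)
  fix I :: "nat set" assume u: "gfree i u" and I: "finite I"
  \<comment> \<open>Moving the generator into its place and out again costs the same sign
    twice.\<close>
  have "gsign {i} I * gsign {i} I = 1" by (simp add: gsign_def flip: power_mult_distrib)
  then have "gsign {i} I * (gsign {i} I * x) = x" for x by (metis mult.assoc mult_1)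
  then show "gcoeff (gderiv i (gen i * u)) I = gcoeff u I"
    using u I by (auto simp: gderiv.rep_eq gcoeff_gen_mult gfree_def)
qed

text \<open>Collect the monomials containing the generator \<open>i\<close> and move it to the
  front: the cofactor is the left derivative, and \<open>a\<close> is the rest. Parity passes to
  \<open>a\<close> because its nonzero coefficients are among those of \<open>u\<close>.\<close>

lemma gfree_decomp:
  obtains a where "gfree i a" "u = a + gen i * gderiv i u"
    "\<And>e. ghomog e u \<Longrightarrow> ghomog e a"
proof
  have sq: "gsign {i} (I - {i}) * (gsign {i} (I - {i}) * x) = x" for I x
    by (simp add: gsign_def flip: power_mult_distrib mult.assoc)
  define a where "a = u - gen i * gderiv i u"
  have a: "gcoeff a I = (if i \<in> I then 0 else gcoeff u I)" for I
    by (cases "finite I")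
      (auto simp: a_def gcoeff_gen_mult gderiv.rep_eq insert_absorb sq)
  show "gfree i a" "\<And>e. ghomog e u \<Longrightarrow> ghomog e a"
    by (auto simp: gfree_def ghomog_def a)
  show "u = a + gen i * gderiv i u" by (simp add: a_def)
qed

lemma ghomog_gderiv: "ghomog e u \<Longrightarrow> ghomog (e + 1) (gderiv i u)"
  unfolding ghomog_def
proof (intro allI impI)
  fix I assume u: "\<forall>I. gcoeff u I \<noteq> 0 \<longrightarrow> even (card I) = even e" and nz: "gcoeff (gderiv i u) I \<noteq> 0"
  then have "i \<notin> I" "gcoeff u (insert i I) \<noteq> 0" by (auto simp: gderiv.rep_eq split: if_splits)
  moreover have "finite I" using nz gcoeff_infinite by blast
  ultimately show "even (card I) = even (e + 1)" using u by fastforce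
qed

text \<open>By anticommutation the square of a generator is its own negative, hence 0 over the
  reals.\<close>

lemma gen_mult_self: "gen i * (gen i * u) = 0"
proof -
  have "gen i * gen i = - (gen i * gen i)"
    using ghomog_commute[OF ghomog_gen ghomog_gen, of i i] by simp
  then have "2 *\<^sub>R (gen i * gen i) = 0" unfolding scaleR_2 by (metis add.right_inverse)
  then show ?thesis by (simp add: mult.assoc[symmetric])
qed

text \<open>Write \<open>u = a + gen i * b\<close> and \<open>v = c + gen i * d\<close> with
  \<open>a\<close>, \<open>b\<close>, \<open>c\<close>, \<open>d\<close> free of the generator.
  Evenness of \<open>u\<close> makes \<open>a\<close> even and \<open>b\<close> odd, and the product
  has derivative \<open>b * c + a * d\<close>. In \<open>b * v + u * d\<close> the two additional
  terms \<open>b * (gen i * d)\<close> and \<open>gen i * (b * d)\<close> cancel, since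
  \<open>b\<close> anticommutes with \<open>gen i\<close>.\<close>

lemma gderiv_mult:
  assumes u: "ghomog 0 u"
  shows "gderiv i (u * v) = gderiv i u * v + u * gderiv i v"
proof -
  obtain a where a: "gfree i a" "u = a + gen i * gderiv i u" "ghomog 0 a"
    using gfree_decomp u by metis
  obtain c where c: "gfree i c" "v = c + gen i * gderiv i v"
    using gfree_decomp by metis
  define b d where "b = gderiv i u" and "d = gderiv i v"
  have bd: "gfree i b" "gfree i d" by (auto simp: b_def d_def gfree_gderiv)
  have "ghomog 1 b" using ghomog_gderiv[OF u] by (simp add: b_def)
  then have b: "b * gen i = - (gen i * b)" using ghomog_commute[OF _ ghomog_gen] by fastforce
  have b': "b * (gen i * w) = - (gen i * (b * w))" for w
    using b by (metis mult.assoc mult_minus_left)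
  have ai: "a * (gen i * w) = gen i * (a * w)" for w
    using ghomog_0_commute[OF a(3)] by (metis mult.assoc)
  have uv: "u = a + gen i * b" "v = c + gen i * d" using a c by (auto simp: b_def d_def)
  have "u * v = a * c + gen i * (b * c + a * d)"
    unfolding uv by (simp add: algebra_simps b' ai gen_mult_self)
  then have "gderiv i (u * v) = b * c + a * d"
    using a c bd by (simp add: gderiv_add gderiv_free gderiv_gen_mult gfree_mult gfree_add)
  also have "\<dots> = b * v + u * d"
    unfolding uv by (simp add: algebra_simps b')
  finally show ?thesis by (simp add: b_def d_def)
qed

section \<open>Parity and support bounds, nilpotent souls, the exponential\<close>

lemma ghomog_0 [simp]: "ghomog e 0"
  by (simp add: ghomog_def)

lemma ghomog_add: "ghomog e u \<Longrightarrow> ghomog e v \<Longrightarrow> ghomog e (u + v)"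
  unfolding ghomog_def plus_grassmann.rep_eq by (metis add_0)

lemma ghomog_scaleR: "ghomog e u \<Longrightarrow> ghomog e (r *\<^sub>R u)"
  by (simp add: ghomog_def)

lemma ghomog_of_real: "ghomog 0 (of_real r)"
  by (simp add: ghomog_def gcoeff_of_real)

lemma ghomog_power: "ghomog 0 u \<Longrightarrow> ghomog 0 (u ^ k)"
proof (induction k)
  case 0
  then show ?case by (simp add: ghomog_def)
next
  case (Suc k)
  then show ?case using ghomog_mult[of 0 u 0] by simp
qed

lemma ghomog_sum: "(\<And>a. a \<in> A \<Longrightarrow> ghomog e (f a)) \<Longrightarrow> ghomog e (sum f A)"
  by (induction A rule: infinite_finite_induct) (auto intro: ghomog_add)

text \<open>The type has infinitely many generators; a bound on those that occur is what makes souls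
  nilpotent.\<close>

definition gsupp :: "nat \<Rightarrow> grassmann \<Rightarrow> bool" where
  "gsupp m u \<longleftrightarrow> (\<forall>I. gcoeff u I \<noteq> 0 \<longrightarrow> I \<subseteq> {..<m})"

lemma gsupp_mult:
  assumes "gsupp m u" "gsupp m v"
  shows "gsupp m (u * v)"
  unfolding gsupp_def
proof (intro allI impI)
  fix I assume "gcoeff (u * v) I \<noteq> 0"
  then obtain J where "J \<subseteq> I" "gcoeff u J \<noteq> 0" "gcoeff v (I - J) \<noteq> 0"
    by (rule gcoeff_mult_nonzero)
  then show "I \<subseteq> {..<m}"
    using assms unfolding gsupp_def by blast
qed

lemma gsupp_0 [simp]: "gsupp m 0"
  by (simp add: gsupp_def)

lemma gsupp_add: "gsupp m u \<Longrightarrow> gsupp m v \<Longrightarrow> gsupp m (u + v)"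
  unfolding gsupp_def plus_grassmann.rep_eq by (metis add_0)

lemma gsupp_scaleR: "gsupp m u \<Longrightarrow> gsupp m (r *\<^sub>R u)"
  by (simp add: gsupp_def)

lemma gsupp_of_real: "gsupp m (of_real r)"
  by (simp add: gsupp_def gcoeff_of_real)

lemma gsupp_power: "gsupp m u \<Longrightarrow> gsupp m (u ^ k)"
  using gsupp_of_real[of m 1] by (induction k) (auto intro: gsupp_mult)

lemma gsupp_sum: "(\<And>a. a \<in> A \<Longrightarrow> gsupp m (f a)) \<Longrightarrow> gsupp m (sum f A)"
  by (induction A rule: infinite_finite_induct) (auto intro: gsupp_add)

lemma gsupp_gderiv: "gsupp m u \<Longrightarrow> gsupp m (gderiv i u)"
  by (auto simp: gsupp_def gderiv.rep_eq)

definition soul :: "grassmann \<Rightarrow> grassmann" where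
  "soul u = u - of_real (body u)"

lemma body_soul: "gcoeff (soul u) {} = 0"
  by (simp add: soul_def gcoeff_of_real body_def)

lemma gsupp_soul: "gsupp m u \<Longrightarrow> gsupp m (soul u)"
  using gsupp_add[of m u "of_real (- body u)"] gsupp_of_real[of m "- body u"]
  by (simp add: soul_def)

lemma ghomog_soul: "ghomog 0 u \<Longrightarrow> ghomog 0 (soul u)"
  using ghomog_add[of 0 u "of_real (- body u)"] ghomog_of_real[of "- body u"]
  by (simp add: soul_def)

lemma body_add: "body (u + v) = body u + body v"
  by (simp add: body_def)

lemma soul_add: "soul (u + v) = soul u + soul v"
  by (simp add: soul_def body_add)

text \<open>Each factor \<open>soul u\<close> contributes at least one generator, and the factors of
  a monomial use disjoint sets of generators.\<close>

lemma soul_power_card: "gcoeff (soul u ^ k) I \<noteq> 0 \<Longrightarrow> k \<le> card I"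
proof (induction k arbitrary: I)
  case (Suc k)
  then obtain J where J: "finite I" "J \<subseteq> I" "gcoeff (soul u) J \<noteq> 0" "gcoeff (soul u ^ k) (I - J) \<noteq> 0"
    by (metis gcoeff_mult_nonzero power_Suc)
  have "J \<noteq> {}" using J body_soul by metis
  then have "1 \<le> card J" using J by (metis card_gt_0_iff finite_subset less_eq_Suc_le One_nat_def)
  moreover have "k \<le> card (I - J)" using Suc.IH J by blast
  moreover have "card I = card J + card (I - J)"
    using J by (metis card_mono card_Diff_subset finite_subset le_add_diff_inverse)
  ultimately show ?case by simp
qed simp

lemma soul_nilpotent:
  assumes "gsupp m u" "m < k"
  shows "soul u ^ k = 0"
proof (rule gcoeff_inject_ext, rule ccontr)
  fix I assume "gcoeff (soul u ^ k) I \<noteq> gcoeff 0 I"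
  then have nz: "gcoeff (soul u ^ k) I \<noteq> 0" by simp
  then have "I \<subseteq> {..<m}" using gsupp_power[OF gsupp_soul[OF assms(1)]] by (auto simp: gsupp_def)
  then have "card I \<le> m" by (metis card_lessThan card_mono finite_lessThan)
  then show False using soul_power_card[OF nz] assms(2) by simp
qed

text \<open>\<open>gexp\<close> sums over the nonzero powers, an index set that varies with
  \<open>u\<close>. A range \<open>{..<N}\<close> common to many elements permits termwise work;
  \<open>N\<close> stays free because the product formula compares ranges of different
  lengths.\<close>

lemma gexp_eq:
  assumes "gsupp m u" "m < N"
  shows "gexp u = exp (body u) *\<^sub>R (\<Sum>k<N. (1 / fact k) *\<^sub>R soul u ^ k)"
proof -
  have "(\<Sum>k | soul u ^ k \<noteq> 0. (1 / fact k) *\<^sub>R soul u ^ k) = (\<Sum>k<N. (1 / fact k) *\<^sub>R soul u ^ k)"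
  proof (rule sum.mono_neutral_left)
    show "{k. soul u ^ k \<noteq> 0} \<subseteq> {..<N}"
      using soul_nilpotent[OF assms(1)] assms(2) by (force simp: not_less)
  qed auto
  then show ?thesis by (simp add: gexp_def soul_def)
qed

text \<open>The Grassmann algebra is not commutative, so the formula is derived by Pascal's rule
  from the commutation of this one pair.\<close>

lemma binomial_commuting:
  fixes x y :: "'a::real_algebra_1"
  assumes "x * y = y * x"
  shows "(x + y) ^ n = (\<Sum>k\<le>n. real (n choose k) *\<^sub>R (x ^ k * y ^ (n - k)))"
proof (induction n)
  case (Suc n)
  have "y * (x ^ k * w) = x ^ k * (y * w)" for k w
    using power_commuting_commutes[OF assms, of k] by (metis mult.assoc)
  then have "(x + y) ^ Suc n =
      (\<Sum>k\<le>n. real (n choose k) *\<^sub>R (x ^ Suc k * y ^ (n - k))) +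
      (\<Sum>k\<le>n. real (n choose k) *\<^sub>R (x ^ k * y ^ (Suc n - k)))"
    by (simp add: Suc.IH distrib_right sum_distrib_left mult.assoc Suc_diff_le sum.distrib scaleR_add_right)
  also have "(\<Sum>k\<le>n. real (n choose k) *\<^sub>R (x ^ k * y ^ (Suc n - k))) =
      (\<Sum>k\<le>Suc n. real (n choose k) *\<^sub>R (x ^ k * y ^ (Suc n - k)))"
    by simp
  also have "\<dots> = y ^ Suc n + (\<Sum>k\<le>n. real (n choose Suc k) *\<^sub>R (x ^ Suc k * y ^ (n - k)))"
    by (subst sum.atMost_Suc_shift) simp
  also have "(\<Sum>k\<le>n. real (n choose k) *\<^sub>R (x ^ Suc k * y ^ (n - k))) + \<dots> =
      (\<Sum>k\<le>Suc n. real (Suc n choose k) *\<^sub>R (x ^ k * y ^ (Suc n - k)))"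
    by (subst sum.atMost_Suc_shift) (simp add: sum.distrib scaleR_add_left ac_simps)
  finally show ?case .
qed simp

lemma exp_terms_add:
  fixes x y :: "'a::real_algebra_1"
  assumes "x * y = y * x"
  shows "(1 / fact n) *\<^sub>R (x + y) ^ n =
    (\<Sum>i\<le>n. ((1 / fact i) *\<^sub>R x ^ i) * ((1 / fact (n - i)) *\<^sub>R y ^ (n - i)))"
  by (auto simp: binomial_commuting[OF assms] scaleR_right.sum binomial_fact intro!: sum.cong)

text \<open>The body is additive and is handled by the real exponential. The soul of the even
  \<open>u\<close> commutes with that of \<open>v\<close>, so the binomial theorem gives the Cauchy
  product of the two finite series.\<close>

lemma gexp_add:
  assumes "gsupp m u" "gsupp m v" "ghomog 0 u"
  shows "gexp (u + v) = gexp u * gexp v"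
proof -
  define X Y where "X = (\<lambda>k. (1 / fact k) *\<^sub>R soul u ^ k)" and "Y = (\<lambda>k. (1 / fact k) *\<^sub>R soul v ^ k)"
  have "X k = 0" "Y k = 0" if "m < k" for k
    using that soul_nilpotent assms by (auto simp: X_def Y_def)
  then have z: "i \<le> m" "j \<le> m" if "X i * Y j \<noteq> 0" for i j
    using that by (metis mult_zero_left mult_zero_right not_le)+
  have "(\<Sum>k<2 * m + 1. (1 / fact k) *\<^sub>R (soul u + soul v) ^ k) = (\<Sum>k<2 * m + 1. \<Sum>i\<le>k. X i * Y (k - i))"
    using exp_terms_add[of "soul u" "soul v"] ghomog_0_commute[OF ghomog_soul[OF assms(3)]]
    by (simp add: X_def Y_def)
  also have "\<dots> = (\<Sum>(i, j) | i + j < 2 * m + 1. X i * Y j)"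
    by (simp add: sum.triangle_reindex)
  \<comment> \<open>Terms with \<open>i\<close> or \<open>j\<close> above \<open>m\<close> vanish,
    and the square \<open>i, j \<le> m\<close> lies inside the triangle
    \<open>i + j < 2 * m + 1\<close>: this is why the series of the sum is taken with
    \<open>2 * m + 1\<close> terms.\<close>
  also have "\<dots> = (\<Sum>(i, j)\<in>{..<m + 1} \<times> {..<m + 1}. X i * Y j)"
  proof (rule sum.mono_neutral_right)
    show "finite {(i, j). i + j < 2 * m + 1}"
      by (rule finite_subset[of _ "{..<2 * m + 1} \<times> {..<2 * m + 1}"]) auto
  qed (use z in \<open>auto simp: less_Suc_eq_le\<close>)
  also have "\<dots> = (\<Sum>i<m + 1. X i) * (\<Sum>j<m + 1. Y j)"
    unfolding sum_product sum.cartesian_product ..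
  finally have *: "(\<Sum>k<2 * m + 1. (1 / fact k) *\<^sub>R (soul u + soul v) ^ k) =
    (\<Sum>i<m + 1. X i) * (\<Sum>j<m + 1. Y j)" .
  show ?thesis
    using gexp_eq[OF assms(1), of "m + 1"] gexp_eq[OF assms(2), of "m + 1"]
      gexp_eq[OF gsupp_add[OF assms(1,2)], of "2 * m + 1"] *
    by (cases "m = 0") (auto simp: soul_add body_add exp_add X_def Y_def)
qed

lemma gexp_0 [simp]: "gexp 0 = 1"
  using gexp_eq[of 0 0 1] by (simp add: body_def)

lemma ghomog_gexp:
  assumes "gsupp m u" "ghomog 0 u"
  shows "ghomog 0 (gexp u)"
  by (subst gexp_eq[OF assms(1) lessI])
    (intro ghomog_scaleR ghomog_sum ghomog_power ghomog_soul assms)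

lemma gsupp_gexp: "gsupp m u \<Longrightarrow> gsupp m (gexp u)"
  by (subst gexp_eq[OF _ lessI]) (assumption, intro gsupp_scaleR gsupp_sum gsupp_power gsupp_soul)


section \<open>Smooth functions\<close>

text \<open>Superfunctions carry the value 0 outside \<open>W\<close>. Derivatives at a point of
  \<open>W\<close> see only values on \<open>W\<close> because a coordinate line through the point
  stays in \<open>W\<close> nearby.\<close>

lemma eventually_line:
  assumes W: "openin (Euclidean_space n) W" and x: "x \<in> W" and i: "i < n"
  shows "eventually (\<lambda>t. x(i := t) \<in> W) (nhds (x i))"
proof -
  have xn: "\<forall>j\<ge>n. x j = 0"
    using openin_subset[OF W] x by (auto simp: topspace_Euclidean_space)
  have "continuous_map euclideanreal (Euclidean_space n) (\<lambda>t. x(i := t))"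
    unfolding Euclidean_space_def continuous_map_in_subtopology continuous_map_componentwise_UNIV
    using xn i by (auto simp: fun_upd_def)
  then have "open {t. x(i := t) \<in> W}"
    using openin_continuous_map_preimage[OF _ W] by fastforce
  moreover have "x i \<in> {t. x(i := t) \<in> W}" using x by simp
  ultimately show ?thesis by (metis (mono_tags, lifting) eventually_nhds mem_Collect_eq)
qed

text \<open>The existence half of a partial derivative: \<open>partial\<close> is defined through
  \<open>deriv\<close>, whose value is informative only where the derivative exists.\<close>

definition linewise_differentiable :: "nat \<Rightarrow> (point \<Rightarrow> real) \<Rightarrow> point \<Rightarrow> bool" where
  "linewise_differentiable i f x \<longleftrightarrow> (\<lambda>t. f (x(i := t))) differentiable at (x i)"

lemma linewise_differentiable_iff:
  "linewise_differentiable i f x \<longleftrightarrow>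
    ((\<lambda>t. f (x(i := t))) has_real_derivative partial i f x) (at (x i))"
  by (simp add: linewise_differentiable_def partial_def DERIV_deriv_iff_real_differentiable)

lemma linewise_derivI:
  assumes "((\<lambda>t. f (x(i := t))) has_real_derivative D) (at (x i))"
  shows "linewise_differentiable i f x" "partial i f x = D"
  using assms DERIV_imp_deriv
  by (auto simp: linewise_differentiable_def partial_def real_differentiable_def)

lemma linewise_cong:
  assumes "openin (Euclidean_space n) W" "x \<in> W" "i < n" "\<And>y. y \<in> W \<Longrightarrow> f y = g y"
  shows "partial i f x = partial i g x"
    "linewise_differentiable i f x \<longleftrightarrow> linewise_differentiable i g x"
proof -
  have ev: "eventually (\<lambda>t. f (x(i := t)) = g (x(i := t))) (nhds (x i))"
    using eventually_line[OF assms(1-3)] by eventually_elim (use assms(4) in auto)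
  show *: "partial i f x = partial i g x"
    unfolding partial_def by (rule deriv_cong_ev[OF ev refl])
  show "linewise_differentiable i f x \<longleftrightarrow> linewise_differentiable i g x"
    unfolding linewise_differentiable_iff * by (rule DERIV_cong_ev[OF refl ev refl])
qed

lemma partial_add:
  assumes "linewise_differentiable i f x" "linewise_differentiable i g x"
  shows "linewise_differentiable i (\<lambda>x. f x + g x) x"
    "partial i (\<lambda>x. f x + g x) x = partial i f x + partial i g x"
proof -
  have "((\<lambda>t. f (x(i := t)) + g (x(i := t))) has_real_derivative
      partial i f x + partial i g x) (at (x i))"
    using assms unfolding linewise_differentiable_iff by (rule DERIV_add)
  then show "linewise_differentiable i (\<lambda>x. f x + g x) x"
    "partial i (\<lambda>x. f x + g x) x = partial i f x + partial i g x"
    by (rule linewise_derivI)+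
qed

lemma partial_mult:
  assumes "linewise_differentiable i f x" "linewise_differentiable i g x"
  shows "linewise_differentiable i (\<lambda>x. f x * g x) x"
    "partial i (\<lambda>x. f x * g x) x = partial i f x * g x + f x * partial i g x"
proof -
  have "((\<lambda>t. f (x(i := t)) * g (x(i := t))) has_real_derivative
      partial i f x * g x + f x * partial i g x) (at (x i))"
    using assms unfolding linewise_differentiable_iff by (auto intro!: derivative_eq_intros)
  then show "linewise_differentiable i (\<lambda>x. f x * g x) x"
    "partial i (\<lambda>x. f x * g x) x = partial i f x * g x + f x * partial i g x"
    by (rule linewise_derivI)+
qed

lemma partial_exp:
  assumes "linewise_differentiable i f x"
  shows "linewise_differentiable i (\<lambda>x. exp (f x)) x"
    "partial i (\<lambda>x. exp (f x)) x = exp (f x) * partial i f x"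
proof -
  have "((\<lambda>t. exp (f (x(i := t)))) has_real_derivative exp (f x) * partial i f x) (at (x i))"
    using assms unfolding linewise_differentiable_iff by (auto intro!: derivative_eq_intros)
  then show "linewise_differentiable i (\<lambda>x. exp (f x)) x"
    "partial i (\<lambda>x. exp (f x)) x = exp (f x) * partial i f x"
    by (rule linewise_derivI)+
qed

lemma partial_const [simp]: "partial i (\<lambda>x. r) x = 0"
  by (simp add: partial_def)

section \<open>Smooth functions and their closure properties\<close>

lemma smooth_on_iff:
  "smooth_on n W g \<longleftrightarrow> (\<forall>is. set is \<subseteq> {..<n} \<longrightarrow>
     continuous_map (subtopology (Euclidean_space n) W) euclideanreal (foldr partial is g) \<and>
     (\<forall>x\<in>W. \<forall>i<n. linewise_differentiable i (foldr partial is g) x))"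
  by (simp add: smooth_on_def linewise_differentiable_def)

lemma smooth_on_continuous_map:
  "smooth_on n W g \<Longrightarrow> continuous_map (subtopology (Euclidean_space n) W) euclideanreal g"
  unfolding smooth_on_iff by (drule spec[of _ "[]"]) simp

lemma smooth_on_linewise_differentiable:
  "smooth_on n W g \<Longrightarrow> x \<in> W \<Longrightarrow> i < n \<Longrightarrow> linewise_differentiable i g x"
  unfolding smooth_on_iff by (drule spec[of _ "[]"]) simp

lemma smooth_on_partial: "smooth_on n W g \<Longrightarrow> i < n \<Longrightarrow> smooth_on n W (partial i g)"
  unfolding smooth_on_iff
proof (intro allI impI)
  fix "is" assume g: "\<forall>is. set is \<subseteq> {..<n} \<longrightarrow>
     continuous_map (subtopology (Euclidean_space n) W) euclideanreal (foldr partial is g) \<and>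
     (\<forall>x\<in>W. \<forall>i<n. linewise_differentiable i (foldr partial is g) x)" "i < n" "set is \<subseteq> {..<n}"
  show "continuous_map (subtopology (Euclidean_space n) W) euclideanreal (foldr partial is (partial i g)) \<and>
     (\<forall>x\<in>W. \<forall>j<n. linewise_differentiable j (foldr partial is (partial i g)) x)"
    using g(1)[rule_format, of "is @ [i]"] g(2,3) by simp
qed

text \<open>By induction on the list of directions, every iterated derivative of \<open>f\<close>
  agrees on \<open>W\<close> with a member of the class \<open>P\<close>, and so inherits continuity
  and differentiability. Agreement on \<open>W\<close> is all that can be asked, since
  \<open>partial\<close> is uncontrolled elsewhere; locality carries it through one more
  derivative.\<close>

lemma smooth_on_coinduct:
  assumes W: "openin (Euclidean_space n) W" and "P f"
    and cont: "\<And>f. P f \<Longrightarrow> continuous_map (subtopology (Euclidean_space n) W) euclideanreal f"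
    and diff: "\<And>f x i. P f \<Longrightarrow> x \<in> W \<Longrightarrow> i < n \<Longrightarrow> linewise_differentiable i f x"
    and step: "\<And>f i. P f \<Longrightarrow> i < n \<Longrightarrow> \<exists>h. P h \<and> (\<forall>x\<in>W. partial i f x = h x)"
  shows "smooth_on n W f"
  unfolding smooth_on_iff
proof (intro allI impI)
  fix "is" assume "set is \<subseteq> {..<n}"
  then have "\<exists>h. P h \<and> (\<forall>x\<in>W. foldr partial is f x = h x)"
  proof (induction "is")
    case Nil
    then show ?case using \<open>P f\<close> by auto
  next
    case (Cons i "is")
    then obtain h where h: "P h" "\<forall>x\<in>W. foldr partial is f x = h x" by auto
    moreover obtain h' where "P h'" "\<forall>x\<in>W. partial i h x = h' x" using step[OF h(1), of i] Cons.prems by auto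
    ultimately show ?case
      using linewise_cong(1)[OF W, of _ i "foldr partial is f" h] Cons.prems by auto
  qed
  then obtain h where h: "P h" "\<forall>x\<in>W. foldr partial is f x = h x" by blast
  have "continuous_map (subtopology (Euclidean_space n) W) euclideanreal (foldr partial is f)"
    by (rule continuous_map_eq[OF cont[OF h(1)]]) (use h in auto)
  then show "continuous_map (subtopology (Euclidean_space n) W) euclideanreal (foldr partial is f) \<and>
     (\<forall>x\<in>W. \<forall>i<n. linewise_differentiable i (foldr partial is f) x)"
    using linewise_cong(2)[OF W, of _ _ "foldr partial is f" h] diff[OF h(1)] h(2) by auto
qed

text \<open>A class of functions containing the partial derivatives of its members, up to equality on \<open>W\<close>.\<close>

inductive smooth_expr :: "nat \<Rightarrow> point set \<Rightarrow> (point \<Rightarrow> real) \<Rightarrow> bool" for n W where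
  base: "smooth_on n W f \<Longrightarrow> smooth_expr n W f"
| exp: "smooth_on n W f \<Longrightarrow> smooth_expr n W (\<lambda>x. exp (f x))"
| add: "smooth_expr n W f \<Longrightarrow> smooth_expr n W g \<Longrightarrow> smooth_expr n W (\<lambda>x. f x + g x)"
| mult: "smooth_expr n W f \<Longrightarrow> smooth_expr n W g \<Longrightarrow> smooth_expr n W (\<lambda>x. f x * g x)"

lemma smooth_expr_linewise_differentiable:
  assumes "smooth_expr n W f" "x \<in> W" "i < n"
  shows "linewise_differentiable i f x"
  using assms(1)
proof (induction rule: smooth_expr.induct)
  case (base f)
  then show ?case using smooth_on_linewise_differentiable assms(2,3) by blast
next
  case (exp f)
  then show ?case using smooth_on_linewise_differentiable partial_exp(1) assms(2,3) by blast
next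
  case (add f g)
  show ?case by (rule partial_add(1)[OF add.IH])
next
  case (mult f g)
  show ?case by (rule partial_mult(1)[OF mult.IH])
qed

lemma smooth_expr_continuous_map:
  "smooth_expr n W f \<Longrightarrow> continuous_map (subtopology (Euclidean_space n) W) euclideanreal f"
proof (induction rule: smooth_expr.induct)
  case (base f)
  then show ?case by (rule smooth_on_continuous_map)
next
  case (exp f)
  have "continuous_map euclideanreal euclideanreal (exp :: real \<Rightarrow> real)"
    by (simp add: continuous_map_iff_continuous2 continuous_on_exp)
  then have "continuous_map (subtopology (Euclidean_space n) W) euclideanreal (exp \<circ> f)"
    by (rule continuous_map_compose[OF smooth_on_continuous_map[OF exp]])
  then show ?case by (simp add: o_def)
next
  case (add f g)
  show ?case by (rule continuous_map_add[OF add.IH])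
next
  case (mult f g)
  show ?case by (rule continuous_map_real_mult[OF mult.IH])
qed

lemma smooth_expr_partial:
  assumes "smooth_expr n W f" "i < n"
  shows "\<exists>h. smooth_expr n W h \<and> (\<forall>x\<in>W. partial i f x = h x)"
  using assms(1)
proof (induction rule: smooth_expr.induct)
  case (base f)
  then show ?case using smooth_on_partial[of n W f i] assms smooth_expr.base by blast
next
  case (exp f)
  have "smooth_expr n W (\<lambda>x. exp (f x) * partial i f x)"
    using exp smooth_on_partial[of n W f i] assms by (intro smooth_expr.intros)
  then show ?case using exp partial_exp smooth_on_linewise_differentiable assms(2) by blast
next
  case (add f g)
  then obtain f' g' where d: "smooth_expr n W f'" "\<forall>x\<in>W. partial i f x = f' x"
    "smooth_expr n W g'" "\<forall>x\<in>W. partial i g x = g' x" by blast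
  have "smooth_expr n W (\<lambda>x. f' x + g' x)"
    by (rule smooth_expr.add[OF d(1,3)])
  moreover have "partial i (\<lambda>x. f x + g x) x = f' x + g' x" if "x \<in> W" for x
    using partial_add(2)[OF smooth_expr_linewise_differentiable smooth_expr_linewise_differentiable]
      add.hyps d that assms(2) by simp
  ultimately show ?case by blast
next
  case (mult f g)
  then obtain f' g' where d: "smooth_expr n W f'" "\<forall>x\<in>W. partial i f x = f' x"
    "smooth_expr n W g'" "\<forall>x\<in>W. partial i g x = g' x" by blast
  have "smooth_expr n W (\<lambda>x. f' x * g x + f x * g' x)"
    by (rule smooth_expr.add[OF smooth_expr.mult[OF d(1) mult.hyps(2)]
        smooth_expr.mult[OF mult.hyps(1) d(3)]])
  moreover have "partial i (\<lambda>x. f x * g x) x = f' x * g x + f x * g' x" if "x \<in> W" for x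
    using partial_mult(2)[OF smooth_expr_linewise_differentiable smooth_expr_linewise_differentiable]
      mult.hyps d that assms(2) by simp
  ultimately show ?case by blast
qed

lemma smooth_expr_smooth_on:
  assumes "openin (Euclidean_space n) W" "smooth_expr n W f"
  shows "smooth_on n W f"
  by (rule smooth_on_coinduct[OF assms smooth_expr_continuous_map
        smooth_expr_linewise_differentiable smooth_expr_partial])

text \<open>The class for the coinduction consists of the functions that agree on \<open>W\<close>
  with some function smooth on \<open>V\<close>; this covers both shrinking the domain and changing
  values outside \<open>W\<close>.\<close>

lemma smooth_on_cong:
  assumes W: "openin (Euclidean_space n) W" and "smooth_on n V g" "W \<subseteq> V" "\<And>x. x \<in> W \<Longrightarrow> f x = g x"
  shows "smooth_on n W f"
proof (rule smooth_on_coinduct[of n W "\<lambda>f. \<exists>g. smooth_on n V g \<and> (\<forall>x\<in>W. f x = g x)", OF W])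
  show "\<exists>g. smooth_on n V g \<and> (\<forall>x\<in>W. f x = g x)" using assms by blast
next
  fix f assume "\<exists>g. smooth_on n V g \<and> (\<forall>x\<in>W. f x = g x)"
  then obtain g where g: "smooth_on n V g" "\<forall>x\<in>W. f x = g x" by blast
  show "continuous_map (subtopology (Euclidean_space n) W) euclideanreal f"
    using continuous_map_from_subtopology_mono[OF smooth_on_continuous_map[OF g(1)] assms(3)]
    by (rule continuous_map_eq) (use g in auto)
  show "linewise_differentiable i f x" if "x \<in> W" "i < n" for x i
    using linewise_cong(2)[OF W that, of f g] smooth_on_linewise_differentiable[OF g(1)] g(2) that assms(3)
    by auto
  show "\<exists>h. (\<exists>g. smooth_on n V g \<and> (\<forall>x\<in>W. h x = g x)) \<and> (\<forall>x\<in>W. partial i f x = h x)" if "i < n" for i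
    using linewise_cong(1)[OF W _ that, of _ f g] smooth_on_partial[OF g(1) that] g(2) by blast
qed

lemma smooth_on_const: "openin (Euclidean_space n) W \<Longrightarrow> smooth_on n W (\<lambda>x. r)"
  by (rule smooth_on_coinduct[of n W "\<lambda>f. \<exists>r. f = (\<lambda>x. r)"])
    (auto simp: linewise_differentiable_def)

lemma smooth_on_add:
  "openin (Euclidean_space n) W \<Longrightarrow> smooth_on n W f \<Longrightarrow> smooth_on n W g \<Longrightarrow> smooth_on n W (\<lambda>x. f x + g x)"
  by (rule smooth_expr_smooth_on[OF _ smooth_expr.add[OF smooth_expr.base smooth_expr.base]])

lemma smooth_on_mult:
  "openin (Euclidean_space n) W \<Longrightarrow> smooth_on n W f \<Longrightarrow> smooth_on n W g \<Longrightarrow> smooth_on n W (\<lambda>x. f x * g x)"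
  by (rule smooth_expr_smooth_on[OF _ smooth_expr.mult[OF smooth_expr.base smooth_expr.base]])

lemma smooth_on_exp:
  "openin (Euclidean_space n) W \<Longrightarrow> smooth_on n W f \<Longrightarrow> smooth_on n W (\<lambda>x. exp (f x))"
  by (rule smooth_expr_smooth_on[OF _ smooth_expr.exp])

lemma smooth_on_sum:
  assumes "openin (Euclidean_space n) W" "\<And>a. a \<in> A \<Longrightarrow> smooth_on n W (f a)"
  shows "smooth_on n W (\<lambda>x. \<Sum>a\<in>A. f a x)"
  using assms(2)
proof (induction A rule: infinite_finite_induct)
  case (insert a A)
  then show ?case using smooth_on_add[OF assms(1), of "f a"] by simp
qed (simp_all add: smooth_on_const[OF assms(1)])


section \<open>The odd Laplacian on a superdomain\<close>

lemma has_parity_iff: "has_parity e f \<longleftrightarrow> (\<forall>x. ghomog e (f x))"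
  by (simp add: has_parity_def ghomog_def)

text \<open>Smoothness separated from vanishing outside \<open>W\<close>, for intermediate functions
  such as the pointwise \<open>gexp\<close>, which is 1 where its argument is 0.\<close>

definition coeffs_smooth :: "nat \<Rightarrow> point set \<Rightarrow> superfun \<Rightarrow> bool" where
  "coeffs_smooth n W f \<longleftrightarrow> (\<forall>I. smooth_on n W (\<lambda>x. gcoeff (f x) I))"

lemma superfuns_iff:
  "f \<in> superfuns n m W \<longleftrightarrow> (\<forall>x. x \<notin> W \<longrightarrow> f x = 0) \<and> (\<forall>x. gsupp m (f x)) \<and> coeffs_smooth n W f"
  by (simp add: superfuns_def gsupp_def coeffs_smooth_def)

lemma superfuns_outside: "f \<in> superfuns n m W \<Longrightarrow> x \<notin> W \<Longrightarrow> f x = 0"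
  by (simp add: superfuns_iff)

lemma superfuns_gsupp: "f \<in> superfuns n m W \<Longrightarrow> gsupp m (f x)"
  by (simp add: superfuns_iff)

lemma has_parity_0_commute: "has_parity 0 f \<Longrightarrow> f * g = g * f"
  by (auto simp: has_parity_iff fun_eq_iff intro: ghomog_0_commute)

lemma has_parity_0_left_commute: "has_parity 0 f \<Longrightarrow> g * (f * h) = f * (g * h)"
  using has_parity_0_commute[of f g] by (simp flip: mult.assoc)

lemma has_parity_zero [simp]: "has_parity e 0"
  by (simp add: has_parity_iff)

lemma has_parity_mult: "has_parity a f \<Longrightarrow> has_parity b g \<Longrightarrow> has_parity (a + b) (f * g)"
  by (simp add: has_parity_iff ghomog_mult)

lemma has_parity_add: "has_parity e f \<Longrightarrow> has_parity e g \<Longrightarrow> has_parity e (f + g)"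
  by (simp add: has_parity_iff ghomog_add)

lemma has_parity_scale_fun: "has_parity e f \<Longrightarrow> has_parity e (scale_fun r f)"
  by (simp add: has_parity_iff scale_fun_def ghomog_scaleR)

lemma has_parity_sum: "(\<And>a. a \<in> A \<Longrightarrow> has_parity e (f a)) \<Longrightarrow> has_parity e (sum f A)"
  by (induction A rule: infinite_finite_induct) (auto intro: has_parity_add)

lemma has_parity_cong: "even e = even e' \<Longrightarrow> has_parity e f = has_parity e' f"
  by (simp add: has_parity_def)

lemma part_same: "has_parity e f \<Longrightarrow> even e = even e' \<Longrightarrow> part e' f = f"
  by (rule ext, rule gcoeff_inject_ext) (auto simp: part_def has_parity_def)

lemma part_other: "has_parity e f \<Longrightarrow> even e \<noteq> even e' \<Longrightarrow> part e' f = 0"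
  by (rule ext, rule gcoeff_inject_ext) (auto simp: part_def has_parity_def)

lemma restr_outside [simp]: "x \<notin> W \<Longrightarrow> restr W f x = 0"
  by (simp add: restr_def)

lemma restr_inside [simp]: "x \<in> W \<Longrightarrow> restr W f x = f x"
  by (simp add: restr_def)

section \<open>Coordinate derivatives\<close>

lemma pd_outside: "x \<notin> W \<Longrightarrow> pd n W a f x = 0"
  by (simp add: pd_def)

lemma gcoeff_pd_even:
  assumes "x \<in> W" "a < n"
  shows "gcoeff (pd n W a f x) I = partial a (\<lambda>y. gcoeff (f y) I) x"
  using assms by (simp add: pd_def gmake.rep_eq)

lemma pd_odd: "x \<in> W \<Longrightarrow> \<not> a < n \<Longrightarrow> pd n W a f x = gderiv (a - n) (f x)"
  by (simp add: pd_def)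

text \<open>A coefficient that vanishes identically has zero derivative, so an even derivative
  creates no new monomials. The point \<open>y\<close> may differ from \<open>x\<close>, as a
  function can vanish where its derivative does not.\<close>

lemma gcoeff_pd_nonzero:
  assumes "gcoeff (pd n W a f x) I \<noteq> 0" "a < n"
  obtains y where "gcoeff (f y) I \<noteq> 0"
proof -
  have x: "x \<in> W" using assms(1) by (metis pd_outside gcoeff_simps(1))
  then have "partial a (\<lambda>y. gcoeff (f y) I) x \<noteq> 0" using assms gcoeff_pd_even by metis
  then show ?thesis using that partial_const by (metis (no_types, lifting) ext)
qed

lemma has_parity_pd:
  assumes f: "has_parity e f"
  shows "has_parity (e + par n a) (pd n W a f)"
proof (cases "a < n")
  case True
  then show ?thesis
    using f gcoeff_pd_nonzero[of n W a f] unfolding has_parity_def par_def by (metis add.right_neutral)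
next
  case False
  then have "ghomog (e + 1) (pd n W a f x)" for x
    using f by (cases "x \<in> W") (simp_all add: pd_odd pd_outside has_parity_iff ghomog_gderiv[simplified])
  then show ?thesis using False by (simp add: has_parity_iff par_def)
qed

lemma pd_zero [simp]: "pd n W a 0 = 0"
proof
  fix x
  have "gderiv (a - n) 0 = 0"
    by (rule gcoeff_inject_ext) (simp add: gderiv.rep_eq)
  then show "pd n W a 0 x = 0 x"
    by (cases "x \<in> W"; cases "a < n") (auto simp: pd_odd pd_outside gcoeff_pd_even intro!: gcoeff_inject_ext)
qed

lemma linewise_sum:
  assumes "\<And>k. k \<in> A \<Longrightarrow> linewise_differentiable i (f k) x"
  shows "linewise_differentiable i (\<lambda>x. \<Sum>k\<in>A. f k x) x"
    "partial i (\<lambda>x. \<Sum>k\<in>A. f k x) x = (\<Sum>k\<in>A. partial i (f k) x)"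
proof -
  have "((\<lambda>t. \<Sum>k\<in>A. f k (x(i := t))) has_real_derivative (\<Sum>k\<in>A. partial i (f k) x)) (at (x i))"
    using assms unfolding linewise_differentiable_iff by (rule DERIV_sum)
  then show "linewise_differentiable i (\<lambda>x. \<Sum>k\<in>A. f k x) x"
    "partial i (\<lambda>x. \<Sum>k\<in>A. f k x) x = (\<Sum>k\<in>A. partial i (f k) x)"
    by (rule linewise_derivI)+
qed

lemma linewise_cmult:
  assumes "linewise_differentiable i f x"
  shows "linewise_differentiable i (\<lambda>x. c * f x) x"
    "partial i (\<lambda>x. c * f x) x = c * partial i f x"
proof -
  have "((\<lambda>t. c * f (x(i := t))) has_real_derivative c * partial i f x) (at (x i))"
    using assms unfolding linewise_differentiable_iff by (rule DERIV_cmult)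
  then show "linewise_differentiable i (\<lambda>x. c * f x) x"
    "partial i (\<lambda>x. c * f x) x = c * partial i f x"
    by (rule linewise_derivI)+
qed

text \<open>The components of a Hamiltonian field are defined as brackets with the coordinates; this
  is what collapses the sum over \<open>a\<close> in such a bracket.\<close>

lemma pd_coord:
  assumes W: "openin (Euclidean_space n) W"
  shows "pd n W b (coord n W a) = (if a = b then const_fun W 1 else 0)"
proof
  fix x
  show "pd n W b (coord n W a) x = (if a = b then const_fun W 1 else 0) x"
  proof (cases "x \<in> W")
    case x: True
    show ?thesis
    proof (cases "b < n")
      case b: True
      have c: "partial b (\<lambda>y. gcoeff (coord n W a y) I) x = (if a = b \<and> I = {} then 1 else 0)" for I
      proof -
        have *: "partial b (\<lambda>y. gcoeff (coord n W a y) I) x =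
            partial b (\<lambda>y. if a < n then if I = {} then y a else 0 else gcoeff (gen (a - n)) I) x"
          by (rule linewise_cong(1)[OF W x b]) (auto simp: coord_def gcoeff_of_real)
        have "((\<lambda>t. (x(b := t)) a) has_real_derivative (if a = b then 1 else 0)) (at (x b))"
          by auto
        from linewise_derivI(2)[of "\<lambda>x. x a", OF this]
        show ?thesis using b unfolding * by (cases "I = {}"; cases "a < n") simp_all
      qed
      show ?thesis
      proof (rule gcoeff_inject_ext)
        fix I
        show "gcoeff (pd n W b (coord n W a) x) I = gcoeff ((if a = b then const_fun W 1 else 0) x) I"
          unfolding gcoeff_pd_even[OF x b] c using x by (simp add: const_fun_def)
      qed
    next
      case False
      have real: "gderiv i (of_real r) = 0" for i r
        by (rule gcoeff_inject_ext) (simp add: gderiv.rep_eq gcoeff_of_real)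
      have "insert i I = {j} \<longleftrightarrow> i = j \<and> I = {}" if "i \<notin> I" for i j :: nat and I
        using that by auto
      then have gen: "gderiv i (gen j) = (if i = j then 1 else 0)" for i j
        by (intro gcoeff_inject_ext) (simp add: gderiv.rep_eq gen.rep_eq)
      have "pd n W b (coord n W a) x = gderiv (b - n) (coord n W a x)"
        using x False by (rule pd_odd)
      then show ?thesis
        using x False by (cases "a < n") (auto simp: const_fun_def coord_def real gen)
    qed
  qed (simp add: pd_outside const_fun_def)
qed

section \<open>Closure of superfunctions under the operations, and the Leibniz rule\<close>

context
  fixes n m :: nat and W :: "point set"
  assumes W: "openin (Euclidean_space n) W"
begin

lemma coeffs_smooth_add: "coeffs_smooth n W f \<Longrightarrow> coeffs_smooth n W g \<Longrightarrow> coeffs_smooth n W (\<lambda>x. f x + g x)"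
  by (simp add: coeffs_smooth_def smooth_on_add[OF W])

lemma coeffs_smooth_mult:
  assumes "coeffs_smooth n W f" "coeffs_smooth n W g"
  shows "coeffs_smooth n W (\<lambda>x. f x * g x)"
  using assms unfolding coeffs_smooth_def gcoeff_mult
  by (intro allI smooth_on_sum[OF W] smooth_on_mult[OF W] smooth_on_const[OF W]) auto

lemma coeffs_smooth_const: "coeffs_smooth n W (\<lambda>x. u)"
  by (simp add: coeffs_smooth_def smooth_on_const[OF W])

lemma coeffs_smooth_scaleR:
  "smooth_on n W r \<Longrightarrow> coeffs_smooth n W f \<Longrightarrow> coeffs_smooth n W (\<lambda>x. r x *\<^sub>R f x)"
  by (simp add: coeffs_smooth_def smooth_on_mult[OF W])

lemma coeffs_smooth_sum:
  "(\<And>a. a \<in> A \<Longrightarrow> coeffs_smooth n W (f a)) \<Longrightarrow> coeffs_smooth n W (\<lambda>x. \<Sum>a\<in>A. f a x)"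
  by (simp add: coeffs_smooth_def gcoeff_sum smooth_on_sum[OF W])

lemma coeffs_smooth_power: "coeffs_smooth n W f \<Longrightarrow> coeffs_smooth n W (\<lambda>x. f x ^ k)"
  by (induction k) (simp_all add: coeffs_smooth_const coeffs_smooth_mult)

lemma coeffs_smooth_cong:
  assumes "coeffs_smooth n V g" "W \<subseteq> V" "\<And>x. x \<in> W \<Longrightarrow> f x = g x"
  shows "coeffs_smooth n W f"
  unfolding coeffs_smooth_def
proof
  fix I
  show "smooth_on n W (\<lambda>x. gcoeff (f x) I)"
    using assms(1) unfolding coeffs_smooth_def
    by (intro smooth_on_cong[OF W _ assms(2), of "\<lambda>x. gcoeff (g x) I"]) (simp_all add: assms(3))
qed

lemma superfuns_restr:
  assumes "coeffs_smooth n V f" "W \<subseteq> V" "\<And>x. x \<in> W \<Longrightarrow> gsupp m (f x)"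
  shows "restr W f \<in> superfuns n m W"
  unfolding superfuns_iff using assms
  by (auto simp: restr_def intro: coeffs_smooth_cong[OF assms(1,2)])

lemma superfuns_zero: "0 \<in> superfuns n m W"
  using coeffs_smooth_const[of 0] by (simp add: superfuns_iff zero_fun_def)

lemma superfuns_add: "f \<in> superfuns n m W \<Longrightarrow> g \<in> superfuns n m W \<Longrightarrow> f + g \<in> superfuns n m W"
  by (simp add: superfuns_iff gsupp_add plus_fun_def coeffs_smooth_add)

lemma superfuns_mult: "f \<in> superfuns n m W \<Longrightarrow> g \<in> superfuns n m W \<Longrightarrow> f * g \<in> superfuns n m W"
  by (simp add: superfuns_iff gsupp_mult times_fun_def coeffs_smooth_mult)

lemma superfuns_sum:
  "(\<And>a. a \<in> A \<Longrightarrow> f a \<in> superfuns n m W) \<Longrightarrow> sum f A \<in> superfuns n m W"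
  by (induction A rule: infinite_finite_induct) (auto intro: superfuns_add superfuns_zero)

lemma superfuns_scale_fun: "f \<in> superfuns n m W \<Longrightarrow> scale_fun r f \<in> superfuns n m W"
  by (simp add: superfuns_iff scale_fun_def gsupp_scaleR coeffs_smooth_scaleR smooth_on_const[OF W])

lemma superfuns_gexp:
  assumes "f \<in> superfuns n m W"
  shows "restr W (\<lambda>x. gexp (f x)) \<in> superfuns n m W"
proof (rule superfuns_restr[OF _ order_refl])
  show "gsupp m (gexp (f x))" for x using gsupp_gexp superfuns_gsupp assms by blast
  have f: "coeffs_smooth n W f" using assms by (simp add: superfuns_iff)
  then have body: "smooth_on n W (\<lambda>x. body (f x))" by (simp add: coeffs_smooth_def body_def)
  have "coeffs_smooth n W (\<lambda>x. f x + (- body (f x)) *\<^sub>R 1)"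
    by (intro coeffs_smooth_add coeffs_smooth_scaleR coeffs_smooth_const f)
      (use smooth_on_mult[OF W smooth_on_const[OF W, of "-1"] body] in simp)
  then have soul: "coeffs_smooth n W (\<lambda>x. soul (f x))"
    by (simp add: soul_def of_real_def)
  \<comment> \<open>One number of terms, \<open>Suc m\<close>, serves all points \<open>x\<close>,
    so smoothness reduces to that of finitely many fixed terms.\<close>
  have "gexp (f x) = exp (body (f x)) *\<^sub>R (\<Sum>k<Suc m. (1 / fact k) *\<^sub>R soul (f x) ^ k)" for x
    using gexp_eq[OF superfuns_gsupp[OF assms] lessI] .
  then show "coeffs_smooth n W (\<lambda>x. gexp (f x))"
    by (simp only:) (intro coeffs_smooth_scaleR coeffs_smooth_sum coeffs_smooth_power soul
        smooth_on_const[OF W] smooth_on_exp[OF W] body)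
qed

lemma superfuns_pd:
  assumes f: "f \<in> superfuns n m W"
  shows "pd n W a f \<in> superfuns n m W"
proof (cases "a < n")
  case True
  have "smooth_on n W (\<lambda>x. gcoeff (pd n W a f x) I)" for I
  proof (rule smooth_on_cong[OF W _ order_refl])
    show "smooth_on n W (partial a (\<lambda>y. gcoeff (f y) I))"
      using f True by (auto simp: superfuns_iff coeffs_smooth_def intro: smooth_on_partial)
  qed (simp add: gcoeff_pd_even True)
  moreover have "gsupp m (pd n W a f x)" for x
    unfolding gsupp_def
  proof (intro allI impI)
    fix I assume "gcoeff (pd n W a f x) I \<noteq> 0"
    then obtain y where "gcoeff (f y) I \<noteq> 0" using True by (rule gcoeff_pd_nonzero)
    then show "I \<subseteq> {..<m}" using superfuns_gsupp[OF f, of y] by (simp add: gsupp_def)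
  qed
  ultimately show ?thesis by (simp add: superfuns_iff coeffs_smooth_def pd_outside)
next
  case False
  have "coeffs_smooth n W (\<lambda>x. gderiv (a - n) (f x))"
    unfolding coeffs_smooth_def
  proof
    fix I
    show "smooth_on n W (\<lambda>x. gcoeff (gderiv (a - n) (f x)) I)"
      using f smooth_on_mult[OF W smooth_on_const[OF W, of "gsign {a - n} I"], of "\<lambda>x. gcoeff (f x) (insert (a - n) I)"]
      by (cases "a - n \<in> I") (simp_all add: gderiv.rep_eq smooth_on_const[OF W] superfuns_iff coeffs_smooth_def)
  qed
  then have "restr W (\<lambda>x. gderiv (a - n) (f x)) \<in> superfuns n m W"
    using superfuns_gsupp[OF f] by (intro superfuns_restr[OF _ order_refl] gsupp_gderiv)
  then show ?thesis using False by (simp add: pd_def)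
qed

lemma superfuns_linewise_differentiable:
  "f \<in> superfuns n m W \<Longrightarrow> x \<in> W \<Longrightarrow> i < n \<Longrightarrow> linewise_differentiable i (\<lambda>y. gcoeff (f y) I) x"
  using smooth_on_linewise_differentiable[of n W "\<lambda>y. gcoeff (f y) I"]
  by (simp add: superfuns_iff coeffs_smooth_def)

lemma pd_add:
  assumes "f \<in> superfuns n m W" "g \<in> superfuns n m W"
  shows "pd n W a (f + g) = pd n W a f + pd n W a g"
proof
  fix x
  show "pd n W a (f + g) x = (pd n W a f + pd n W a g) x"
  proof (cases "x \<in> W"; cases "a < n")
    assume "x \<in> W" "a < n"
    then show ?thesis
      by (intro gcoeff_inject_ext)
        (simp add: gcoeff_pd_even partial_add(2) superfuns_linewise_differentiable assms)
  qed (simp_all add: pd_outside pd_odd gderiv_add)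
qed

text \<open>In an even direction this is the product rule for each term of the convolution, whose
  signs are constants; in an odd direction it is the graded rule, free of signs because
  \<open>f\<close> is even.\<close>

lemma pd_mult:
  assumes "f \<in> superfuns n m W" "g \<in> superfuns n m W" "has_parity 0 f"
  shows "pd n W a (f * g) = pd n W a f * g + f * pd n W a g"
proof
  fix x
  show "pd n W a (f * g) x = (pd n W a f * g + f * pd n W a g) x"
  proof (cases "x \<in> W"; cases "a < n")
    assume x: "x \<in> W" "a < n"
    show ?thesis
    proof (rule gcoeff_inject_ext)
      fix I
      define F where "F J = (\<lambda>y. gcoeff (f y) J)" for J
      define G where "G J = (\<lambda>y. gcoeff (g y) J)" for J
      have d: "linewise_differentiable a (F J) x" "linewise_differentiable a (G J) x" for J
        unfolding F_def G_def by (rule superfuns_linewise_differentiable[OF _ x]; fact)+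
      have "gcoeff (pd n W a (f * g) x) I =
          partial a (\<lambda>y. \<Sum>J\<in>Pow I. gsign J (I - J) * (F J y * G (I - J) y)) x"
        by (simp add: gcoeff_pd_even x gcoeff_mult F_def G_def mult.assoc)
      also have "\<dots> = (\<Sum>J\<in>Pow I. partial a (\<lambda>y. gsign J (I - J) * (F J y * G (I - J) y)) x)"
        by (rule linewise_sum(2)) (intro linewise_cmult(1) partial_mult(1) d)
      also have "\<dots> = (\<Sum>J\<in>Pow I. gsign J (I - J) *
          (partial a (F J) x * G (I - J) x + F J x * partial a (G (I - J)) x))"
        by (intro sum.cong refl) (simp only: linewise_cmult(2)[OF partial_mult(1)[OF d]] partial_mult(2)[OF d])
      also have "\<dots> = gcoeff ((pd n W a f * g + f * pd n W a g) x) I"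
        by (simp add: gcoeff_mult gcoeff_pd_even x F_def G_def sum.distrib[symmetric] algebra_simps)
      finally show "gcoeff (pd n W a (f * g) x) I = gcoeff ((pd n W a f * g + f * pd n W a g) x) I" .
    qed
  qed (use assms(3) in \<open>simp_all add: pd_outside pd_odd gderiv_mult has_parity_iff superfuns_outside[OF assms(1)]\<close>)
qed

end


text \<open>For even \<open>f\<close> this is \<rho> times Delta_\<rho> f: the Hamiltonian field of
  \<open>f\<close> is odd, so the sign (-1)^(|a|(1+1)) in the divergence is 1. Leaving out 1/\<rho>
  keeps inverses out of the algebra.\<close>

definition laplace_expr ::
    "nat \<Rightarrow> nat \<Rightarrow> point set \<Rightarrow> (nat \<Rightarrow> nat \<Rightarrow> superfun) \<Rightarrow> superfun \<Rightarrow> superfun \<Rightarrow> superfun" where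
  "laplace_expr n m W S \<rho> f = (\<Sum>a<n + m. pd n W a (\<rho> * (\<Sum>b<n + m. S a b * pd n W b f)))"

text \<open>Three transpositions turn \<open>u * s * w\<close> into \<open>w * s * u\<close>. Their
  exponents add up to pq + (p+q)(p+q+1), and a product of consecutive integers is even.\<close>

lemma ghomog_reverse3:
  assumes "ghomog p u" "ghomog q w" "ghomog (p + q + 1) s" "p < 2" "q < 2"
  shows "u * s * w = (-1) ^ (p * q) * (w * s * u)"
proof -
  have *: "u * s * w = (-1) ^ (p * (p + q + 1)) * (-1) ^ (p * q) * (-1) ^ ((p + q + 1) * q) * (w * s * u)"
  proof -
    have c: "(-1) ^ k * x = x * (-1) ^ k" for k and x :: grassmann
      by (cases "even k") auto
    have "u * s * w = (-1) ^ (p * (p + q + 1)) * (s * (u * w))"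
      by (simp only: ghomog_commute[OF assms(1,3)] mult.assoc)
    also have "\<dots> = (-1) ^ (p * (p + q + 1)) * ((-1) ^ (p * q) * (s * w * u))"
      by (simp only: ghomog_commute[OF assms(1,2)]) (metis c mult.assoc)
    also have "\<dots> = (-1) ^ (p * (p + q + 1)) * ((-1) ^ (p * q) * ((-1) ^ ((p + q + 1) * q) * (w * s * u)))"
      by (simp only: ghomog_commute[OF assms(3,2)] mult.assoc)
    finally show ?thesis by (simp only: mult.assoc)
  qed
  from assms(4,5) consider "p = 0" | "p = 1" "q = 0" | "p = 1" "q = 1" by linarith
  then show ?thesis by cases (simp_all add: * uminus_power_if)
qed

locale odd_poisson_domain =
  fixes n m :: nat and W :: "point set" and S :: "nat \<Rightarrow> nat \<Rightarrow> superfun"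
  assumes W: "openin (Euclidean_space n) W"
    and S: "\<And>a b. a < n + m \<Longrightarrow> b < n + m \<Longrightarrow> S a b \<in> superfuns n m W"
    and S_parity: "\<And>a b. a < n + m \<Longrightarrow> b < n + m \<Longrightarrow> has_parity (par n a + par n b + 1) (S a b)"
    and S_sym: "\<And>a b. a < n + m \<Longrightarrow> b < n + m \<Longrightarrow> S a b = (-1) ^ (par n a * par n b) * S b a"
begin

text \<open>For even \<open>f\<close> and \<open>g\<close> the derivatives have the parities of the
  coordinates, so reversing the three factors costs \<open>(-1) ^ (par n a * par n b)\<close>,
  exactly the sign that turns \<open>S a b\<close> into \<open>S b a\<close>.\<close>

lemma pd_S_pd_symmetric:
  assumes "a < n + m" "b < n + m" "has_parity 0 f" "has_parity 0 g"
  shows "pd n W a g * (S a b * pd n W b f) = pd n W b f * (S b a * pd n W a g)"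
proof
  fix x
  have h: "ghomog (par n a) (pd n W a g x)" "ghomog (par n b) (pd n W b f x)"
    "ghomog (par n a + par n b + 1) (S a b x)"
    using has_parity_pd[OF assms(4), of n a W] has_parity_pd[OF assms(3), of n b W]
      S_parity[OF assms(1,2)] by (simp_all add: has_parity_iff)
  have c: "u * ((-1) ^ k * v) = (-1) ^ k * (u * v)" for u v :: grassmann and k
    by (cases "even k") auto
  have "S b a x = (-1) ^ (par n a * par n b) * S a b x"
    using S_sym[OF assms(2,1)] by (cases "even (par n a * par n b)") (simp_all add: mult.commute)
  then show "(pd n W a g * (S a b * pd n W b f)) x = (pd n W b f * (S b a * pd n W a g)) x"
    using ghomog_reverse3[OF h] by (simp add: par_def mult.assoc c)
qed

text \<open>Both derivations hit only even functions, so no signs appear in the Leibniz rules.\<close>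

lemma laplace_expr_gauge:
  assumes \<rho>: "\<rho> \<in> superfuns n m W" "has_parity 0 \<rho>"
    and f: "f \<in> superfuns n m W" "has_parity 0 f"
    and g: "g \<in> superfuns n m W" "has_parity 0 g"
  shows "laplace_expr n m W S (f * (f * \<rho>)) g =
    f * (laplace_expr n m W S \<rho> (f * g) - g * laplace_expr n m W S \<rho> f)"
proof -
  define D where "D = pd n W"
  \<comment> \<open>\<open>A a\<close> and \<open>B a\<close> are the components of the Hamiltonian
    fields of \<open>f\<close> and \<open>g\<close>, weighted by \<rho>.\<close>
  define A where "A a = \<rho> * (\<Sum>b<n + m. S a b * D b f)" for a
  define B where "B a = \<rho> * (\<Sum>b<n + m. S a b * D b g)" for a
  have AB: "A a \<in> superfuns n m W" "B a \<in> superfuns n m W" if "a < n + m" for a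
    using that S f g \<rho> unfolding A_def B_def D_def
    by (auto intro!: superfuns_mult[OF W] superfuns_sum[OF W] superfuns_pd[OF W])
  note fc = has_parity_0_left_commute[OF f(2)] and gc = has_parity_0_left_commute[OF g(2)]
    and \<rho>c = has_parity_0_left_commute[OF \<rho>(2)]
  note Df = pd_mult[OF W f(1) _ f(2), folded D_def] and Dg = pd_mult[OF W g(1) _ g(2), folded D_def]
  have D_add: "D a (u + v) = D a u + D a v" if "u \<in> superfuns n m W" "v \<in> superfuns n m W" for a u v
    unfolding D_def using that by (rule pd_add[OF W])
  have Dfg: "D b (f * g) = g * D b f + f * D b g" for b
    using Df[OF g(1)] has_parity_0_commute[OF g(2)] by simp
  have "\<rho> * (\<Sum>b<n + m. S a b * D b (f * g)) = g * A a + f * B a" for a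
    by (simp add: Dfg A_def B_def distrib_left sum.distrib fc gc flip: sum_distrib_left)
  then have "laplace_expr n m W S \<rho> (f * g) = (\<Sum>a<n + m. D a (g * A a + f * B a))"
    by (simp add: laplace_expr_def D_def)
  also have "\<dots> = (\<Sum>a<n + m. D a g * A a + g * D a (A a) + (D a f * B a + f * D a (B a)))"
    using AB f g by (intro sum.cong refl) (simp add: D_add superfuns_mult[OF W] Df Dg)
  finally have 1: "laplace_expr n m W S \<rho> (f * g) = (\<Sum>a<n + m. D a g * A a) + g * (\<Sum>a<n + m. D a (A a))
      + ((\<Sum>a<n + m. D a f * B a) + f * (\<Sum>a<n + m. D a (B a)))"
    by (simp only: sum.distrib sum_distrib_left)
  have 2: "laplace_expr n m W S \<rho> f = (\<Sum>a<n + m. D a (A a))"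
    by (simp add: laplace_expr_def D_def A_def)
  have "(\<Sum>a<n + m. D a g * A a) = \<rho> * (\<Sum>a<n + m. \<Sum>b<n + m. D a g * (S a b * D b f))"
    by (simp add: A_def \<rho>c sum_distrib_left)
  \<comment> \<open>Symmetry term by term, followed by an exchange of the summation indices, turns
    the cross term with \<open>D a g\<close> into the one with \<open>D a f\<close>.\<close>
  also have "(\<Sum>a<n + m. \<Sum>b<n + m. D a g * (S a b * D b f)) =
      (\<Sum>a<n + m. \<Sum>b<n + m. D b f * (S b a * D a g))"
    unfolding D_def by (intro sum.cong refl pd_S_pd_symmetric f g) auto
  also have "\<dots> = (\<Sum>a<n + m. \<Sum>b<n + m. D a f * (S a b * D b g))"
    by (rule sum.swap)
  also have "\<rho> * \<dots> = (\<Sum>a<n + m. D a f * B a)"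
    by (simp add: B_def \<rho>c sum_distrib_left)
  finally have 3: "(\<Sum>a<n + m. D a g * A a) = (\<Sum>a<n + m. D a f * B a)" .
  have "laplace_expr n m W S (f * (f * \<rho>)) g = (\<Sum>a<n + m. D a (f * (f * B a)))"
    by (simp add: laplace_expr_def D_def B_def mult.assoc)
  \<comment> \<open>Each of the two factors \<open>f\<close> contributes one
    \<open>D a f * B a\<close>. By fact \<open>3\<close> these account for the two cross terms in
    fact \<open>1\<close>.\<close>
  also have "\<dots> = (\<Sum>a<n + m. f * (D a f * B a + D a f * B a + f * D a (B a)))"
    using AB f by (intro sum.cong refl) (simp add: Df superfuns_mult[OF W] fc[of "D _ f"] distrib_left)
  also have "\<dots> = f * ((\<Sum>a<n + m. D a f * B a) + (\<Sum>a<n + m. D a f * B a) + f * (\<Sum>a<n + m. D a (B a)))"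
    by (simp only: sum.distrib flip: sum_distrib_left)
  finally show ?thesis unfolding 1 2 3 by (simp add: algebra_simps)
qed

end

lemma pd_const:
  assumes W: "openin (Euclidean_space n) W"
  shows "pd n W a (const_fun W r) = 0"
proof
  fix x
  show "pd n W a (const_fun W r) x = 0 x"
  proof (cases "x \<in> W"; cases "a < n")
    assume x: "x \<in> W" "a < n"
    have "partial a (\<lambda>y. gcoeff (const_fun W r y) I) x = partial a (\<lambda>y. gcoeff (of_real r) I) x" for I
      by (rule linewise_cong(1)[OF W x]) (simp add: const_fun_def)
    then show ?thesis
      using x by (intro gcoeff_inject_ext) (simp add: gcoeff_pd_even)
  next
    assume "x \<in> W" "\<not> a < n"
    then show ?thesis
      by (intro gcoeff_inject_ext) (simp add: pd_odd const_fun_def gderiv.rep_eq gcoeff_of_real)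
  qed (simp_all add: pd_outside)
qed

lemma laplace_expr_const:
  "openin (Euclidean_space n) W \<Longrightarrow> laplace_expr n m W S \<rho> (const_fun W r) = 0"
  by (simp add: laplace_expr_def pd_const)


section \<open>Charts and families\<close>

lemma supermanifold_chart:
  assumes "supermanifold M" "c \<in> charts M"
  shows openin_cdom: "openin (base M) (cdom M c)"
    and openin_crange: "openin (Euclidean_space (edim M)) (crange M c)"
    and homeomorphic_map_chart: "homeomorphic_map (subtopology (base M) (cdom M c))
      (subtopology (Euclidean_space (edim M)) (crange M c)) (cmap M c)"
proof -
  have "\<forall>c\<in>charts M. openin (base M) (cdom M c) \<and>
        openin (Euclidean_space (edim M)) (cmap M c ` cdom M c) \<and>
        homeomorphic_map (subtopology (base M) (cdom M c))
          (subtopology (Euclidean_space (edim M)) (cmap M c ` cdom M c)) (cmap M c)"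
    using assms(1) unfolding supermanifold_def by (elim conjE)
  then show "openin (base M) (cdom M c)" "openin (Euclidean_space (edim M)) (crange M c)"
    "homeomorphic_map (subtopology (base M) (cdom M c))
      (subtopology (Euclidean_space (edim M)) (crange M c)) (cmap M c)"
    using assms(2) unfolding crange_def by auto
qed

lemma openin_overlap:
  assumes M: "supermanifold M" and c: "c \<in> charts M" and d: "d \<in> charts M"
  shows "openin (Euclidean_space (edim M)) (overlap M c d)"
proof -
  note dom = openin_cdom[OF M c] openin_cdom[OF M d] and map = homeomorphic_map_chart[OF M c]
  have "openin (subtopology (base M) (cdom M c)) (cdom M c \<inter> cdom M d)"
    using dom by (simp add: openin_open_subtopology openin_Int)
  then have "openin (subtopology (Euclidean_space (edim M)) (crange M c)) (overlap M c d)"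
    using homeomorphic_imp_open_map[OF map] by (simp add: open_map_def overlap_def)
  then show ?thesis
    using openin_crange[OF M c] by (simp add: openin_open_subtopology)
qed

lemma overlap_subset: "overlap M c d \<subseteq> crange M c"
  by (auto simp: overlap_def crange_def)

lemma sections_cdom: "sections M c (cdom M c) = superfuns (edim M) (odim M) (crange M c)"
  by (simp add: sections_def crange_def)

lemma superalgebra_hom_trans:
  assumes M: "supermanifold M" and c: "c \<in> charts M" and d: "d \<in> charts M"
  shows "superalgebra_hom (edim M) (odim M) (overlap M d c) (overlap M c d)
    (trans M c d (cdom M c \<inter> cdom M d))"
proof -
  have "openin (base M) (cdom M c \<inter> cdom M d)"
    using openin_cdom[OF M] c d by (simp add: openin_Int)
  then have "superalgebra_hom (edim M) (odim M) (cmap M d ` (cdom M c \<inter> cdom M d))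
      (cmap M c ` (cdom M c \<inter> cdom M d)) (trans M c d (cdom M c \<inter> cdom M d))"
    using M c d unfolding supermanifold_def by (elim conjE) simp
  then show ?thesis by (simp add: overlap_def Int_commute)
qed

lemma restr_add: "restr W (f + g) = restr W f + restr W g"
  by (auto simp: restr_def)

lemma restr_zero: "restr W 0 = 0"
  by (auto simp: restr_def)

lemma const_fun_zero: "const_fun W 0 = 0"
  by (auto simp: restr_def const_fun_def)

text \<open>0 is a constant function, and transition maps preserve constants.\<close>

lemma transfer_zero:
  assumes "supermanifold M" "c \<in> charts M" "d \<in> charts M"
  shows "transfer M c d 0 = 0"
proof -
  have "trans M c d (cdom M c \<inter> cdom M d) (const_fun (overlap M d c) 0) = const_fun (overlap M c d) 0"
    using superalgebra_hom_trans[OF assms] by (simp add: superalgebra_hom_def)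
  then show ?thesis by (simp only: transfer_def restr_zero const_fun_zero)
qed

lemma transfer_add:
  assumes "supermanifold M" "c \<in> charts M" "d \<in> charts M"
    and "f \<in> sections M d (cdom M d)" "g \<in> sections M d (cdom M d)"
  shows "transfer M c d (f + g) = transfer M c d f + transfer M c d g"
proof -
  have "restr (overlap M d c) h \<in> superfuns (edim M) (odim M) (overlap M d c)"
    if "h \<in> sections M d (cdom M d)" for h
    using that unfolding sections_cdom superfuns_iff[of h]
    by (intro superfuns_restr[OF openin_overlap[OF assms(1,3,2)] _ overlap_subset]) auto
  then show ?thesis
    using superalgebra_hom_trans[OF assms(1-3)] assms(4,5)
    unfolding transfer_def restr_add superalgebra_hom_def by blast
qed

text \<open>Chartwise conditions without a transition law: the calculus of exponentials and of the
  Laplacian takes place in single charts. Even functions and nondegenerate volume forms transform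
  differently, but both are families of this kind.\<close>

definition even_chart_families :: "('p, 'c) supermfd \<Rightarrow> 'c family set" where
  "even_chart_families M = {f. \<forall>c\<in>charts M.
     f c \<in> superfuns (edim M) (odim M) (crange M c) \<and> has_parity 0 (f c)}"

lemma even_functions_subset: "even_functions M \<subseteq> even_chart_families M"
  by (auto simp: even_functions_def superfunctions_def chart_family_def even_chart_families_def sections_cdom)

lemma nondegenerate_volume_forms_subset: "nondegenerate_volume_forms M \<subseteq> even_chart_families M"
  by (auto simp: nondegenerate_volume_forms_def volume_forms_def chart_family_def even_chart_families_def
      sections_cdom)

section \<open>Even functions and their exponentials\<close>

context
  fixes M :: "('p, 'c) supermfd"
  assumes M: "supermanifold M"
begin

lemma zero_even_function: "0 \<in> even_functions M"
  by (auto simp: even_functions_def superfunctions_def chart_family_def sections_cdom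
      superfuns_zero[OF openin_crange[OF M]] restr_zero transfer_zero[OF M])

lemma add_even_functions:
  assumes "\<sigma> \<in> even_functions M" "\<tau> \<in> even_functions M"
  shows "\<sigma> + \<tau> \<in> even_functions M"
proof -
  have "transfer M c d (\<sigma> d + \<tau> d) = transfer M c d (\<sigma> d) + transfer M c d (\<tau> d)"
    if "c \<in> charts M" "d \<in> charts M" for c d
    using assms that
    by (intro transfer_add[OF M]) (auto simp: even_functions_def superfunctions_def chart_family_def)
  then show ?thesis
    using assms superfuns_add[OF openin_crange[OF M]]
    by (simp add: even_functions_def superfunctions_def chart_family_def sections_cdom restr_add has_parity_add)
qed

lemma uminus_even_functions:
  assumes \<sigma>: "\<sigma> \<in> even_functions M"
  shows "- \<sigma> \<in> even_functions M"
proof -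
  have neg: "- f = scale_fun (- 1) f" for f by (simp add: scale_fun_def fun_eq_iff)
  have 1: "\<sigma> c \<in> superfuns (edim M) (odim M) (crange M c)" "has_parity 0 (\<sigma> c)"
    "- \<sigma> c \<in> superfuns (edim M) (odim M) (crange M c)" "has_parity 0 (- \<sigma> c)" if "c \<in> charts M" for c
    using that \<sigma> superfuns_scale_fun[OF openin_crange[OF M that]] has_parity_scale_fun
    unfolding neg by (auto simp: even_functions_def superfunctions_def chart_family_def sections_cdom)
  have "restr (overlap M c d) (- \<sigma> c) = transfer M c d (- \<sigma> d)" if "c \<in> charts M" "d \<in> charts M" for c d
  proof -
    \<comment> \<open>Additivity of the transition map determines the negative: both sides of the
      goal are additive inverses of one and the same function on the overlap.\<close>
    have "transfer M c d (\<sigma> d) + transfer M c d (- \<sigma> d) = 0"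
      using transfer_add[OF M that, of "\<sigma> d" "- \<sigma> d"] 1[OF that(2)] transfer_zero[OF M that]
      by (simp add: sections_cdom)
    moreover have "restr (overlap M c d) (\<sigma> c) + restr (overlap M c d) (- \<sigma> c) = 0"
      using restr_zero by (simp flip: restr_add)
    moreover have "restr (overlap M c d) (\<sigma> c) = transfer M c d (\<sigma> d)"
      using \<sigma> that by (simp add: even_functions_def superfunctions_def)
    ultimately show ?thesis by (metis add_left_cancel)
  qed
  then show ?thesis
    using 1 \<sigma> by (simp add: even_functions_def superfunctions_def chart_family_def sections_cdom)
qed

lemma even_chart_families_scale:
  "f \<in> even_chart_families M \<Longrightarrow> scale_family r f \<in> even_chart_families M"
  using superfuns_scale_fun[OF openin_crange[OF M]]
  by (simp add: even_chart_families_def scale_family_def has_parity_scale_fun)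

lemma even_chart_families_exp:
  assumes "f \<in> even_chart_families M"
  shows "exp_function M f \<in> even_chart_families M"
proof -
  have "has_parity 0 (restr (crange M c) (\<lambda>x. gexp (f c x)))" if "c \<in> charts M" for c
    using assms that ghomog_gexp[OF superfuns_gsupp]
    by (auto simp: even_chart_families_def has_parity_iff restr_def)
  then show ?thesis
    using assms superfuns_gexp[OF openin_crange[OF M]]
    by (simp add: even_chart_families_def exp_function_def)
qed

lemma exp_function_add:
  assumes "f \<in> even_chart_families M" "g \<in> even_chart_families M"
  shows "exp_function M (f + g) = exp_function M f * exp_function M g"
proof (intro ext)
  fix c x
  show "exp_function M (f + g) c x = (exp_function M f * exp_function M g) c x"
  proof (cases "c \<in> charts M \<and> x \<in> crange M c")
    case True
    then have "gexp (f c x + g c x) = gexp (f c x) * gexp (g c x)"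
      using assms by (intro gexp_add[of "odim M"]) (auto simp: even_chart_families_def superfuns_gsupp has_parity_iff)
    then show ?thesis using True by (simp add: exp_function_def)
  qed (auto simp: exp_function_def)
qed

lemma exp_function_zero: "exp_function M 0 = one_function M"
  by (auto simp: exp_function_def one_function_def const_fun_def)

text \<open>\<open>one_function M\<close> is 0 outside the chart ranges and at indices that are not
  charts, so it acts as a unit only on families that vanish there too.\<close>

lemma one_function_mult:
  assumes "\<And>c x. c \<in> charts M \<Longrightarrow> x \<notin> crange M c \<Longrightarrow> f c x = 0" "\<And>c. c \<notin> charts M \<Longrightarrow> f c = 0"
  shows "one_function M * f = f"
proof (intro ext)
  fix c x
  show "(one_function M * f) c x = f c x"
    using assms(1)[of c x] assms(2)[of c]
    by (cases "c \<in> charts M"; cases "x \<in> crange M c") (simp_all add: one_function_def const_fun_def)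
qed

lemma one_function_mult_volume:
  assumes "\<rho> \<in> nondegenerate_volume_forms M"
  shows "one_function M * \<rho> = \<rho>"
proof (rule one_function_mult)
  show "\<rho> c x = 0" if "c \<in> charts M" "x \<notin> crange M c" for c x
    using that assms nondegenerate_volume_forms_subset superfuns_outside
    by (fastforce simp: even_chart_families_def)
  show "\<rho> c = 0" if "c \<notin> charts M" for c
    using that assms by (simp add: nondegenerate_volume_forms_def volume_forms_def chart_family_def)
qed

lemma one_function_mult_exp: "one_function M * exp_function M f = exp_function M f"
  by (rule one_function_mult) (simp_all add: exp_function_def)

lemma exp_function_mult_commute:
  assumes "f \<in> even_chart_families M" "g \<in> even_chart_families M"
  shows "exp_function M f * exp_function M g = exp_function M g * exp_function M f"
  using exp_function_add[OF assms] exp_function_add[OF assms(2,1)] by (simp add: add.commute)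

lemma exp_function_inverse:
  assumes "f \<in> even_chart_families M" "g \<in> even_chart_families M" "f + g = 0"
  shows "exp_function M f * exp_function M g = one_function M"
  using exp_function_add[OF assms(1,2)] assms(3) exp_function_zero by simp

end

lemma scale_family_add: "scale_family r (f + g) = scale_family r f + scale_family r g"
  by (simp add: scale_family_def scale_fun_def fun_eq_iff scaleR_add_right)

lemma scale_family_add_left: "scale_family (r + s) f = scale_family r f + scale_family s f"
  by (simp add: scale_family_def scale_fun_def fun_eq_iff scaleR_add_left)

lemma scale_family_one [simp]: "scale_family 1 f = f"
  by (simp add: scale_family_def scale_fun_def fun_eq_iff)

lemma scale_family_zero [simp]: "scale_family 0 f = 0" "scale_family r 0 = 0"
  by (simp_all add: scale_family_def scale_fun_def fun_eq_iff)

lemma scale_family_uminus: "scale_family r (- f) = scale_family (- r) f"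
  by (simp add: scale_family_def scale_fun_def fun_eq_iff)


section \<open>The odd Laplacian in charts\<close>

lemma odd_poisson_domain_chart:
  assumes "supermanifold M" "odd_poisson M S" "c \<in> charts M"
  shows "odd_poisson_domain (edim M) (odim M) (crange M c) (S c)"
proof
  show "openin (Euclidean_space (edim M)) (crange M c)" by (rule openin_crange[OF assms(1,3)])
next
  fix a b assume "a < edim M + odim M" "b < edim M + odim M"
  then have "S c a b \<in> sections M c (cdom M c) \<and>
        has_parity (par (edim M) a + par (edim M) b + 1) (S c a b) \<and>
        S c a b = (-1) ^ (par (edim M) a * par (edim M) b) * S c b a"
    using assms(2,3) unfolding odd_poisson_def Let_def by blast
  then show "S c a b \<in> superfuns (edim M) (odim M) (crange M c)"
    "has_parity (par (edim M) a + par (edim M) b + 1) (S c a b)"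
    "S c a b = (-1) ^ (par (edim M) a * par (edim M) b) * S c b a"
    unfolding sections_cdom by blast+
qed

lemma sum_lessThan_2: "(\<Sum>e<2. f e) = f 0 + f (1::nat)" for f :: "nat \<Rightarrow> 'a::comm_monoid_add"
  by (simp add: numeral_2_eq_2)

lemma odd_bracket_zero: "odd_bracket M S c 0 g = 0"
proof -
  have "part e 0 = 0" for e by (rule part_other[of "Suc e"]) auto
  then show ?thesis by (simp only: odd_bracket_def Let_def pd_zero mult_zero_left mult_zero_right sum.neutral_const minus_zero)
qed

text \<open>Bracketing with a coordinate extracts one component, as only one derivative of the
  coordinate is nonzero. The odd part of \<open>f\<close> is 0, which leaves the summand
  \<open>e = 0\<close> with trivial sign.\<close>

lemma odd_bracket_coord:
  assumes W: "openin (Euclidean_space (edim M)) (crange M c)"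
    and f: "has_parity 0 f" and a: "a < edim M + odim M"
  shows "odd_bracket M S c f (coord (edim M) (crange M c) a) =
    - (\<Sum>b<edim M + odim M. S c a b * pd (edim M) (crange M c) b f)"
proof -
  let ?N = "edim M + odim M" and ?D = "pd (edim M) (crange M c)" and ?one = "const_fun (crange M c) 1"
  have p: "part 0 f = f" "part 1 f = 0"
    using part_same[OF f, of 0] part_other[OF f, of 1] by simp_all
  \<comment> \<open>\<open>?one\<close> is 1 only on the chart range, but the factor
    \<open>?D b f\<close> vanishes outside it.\<close>
  have one: "S c a b * ?D b f * ?one = S c a b * ?D b f" for b
  proof
    fix x
    show "(S c a b * ?D b f * ?one) x = (S c a b * ?D b f) x"
      by (cases "x \<in> crange M c") (simp_all add: const_fun_def pd_outside)
  qed
  have "odd_bracket M S c f (coord (edim M) (crange M c) a) =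
      - (\<Sum>a'<?N. \<Sum>b<?N. S c a' b * ?D b f * (if a = a' then ?one else 0))"
    unfolding odd_bracket_def Let_def sum_lessThan_2 p pd_zero pd_coord[OF W]
    by (simp only: mult_zero_left mult_zero_right mult_0 power_0 mult_1 sum.neutral_const add_0_right)
  also have "(\<Sum>a'<?N. \<Sum>b<?N. S c a' b * ?D b f * (if a = a' then ?one else 0)) =
      (\<Sum>a'<?N. if a = a' then \<Sum>b<?N. S c a b * ?D b f * ?one else 0)"
    by (intro sum.cong refl) (simp add: if_distrib cong: if_cong)
  also have "\<dots> = (\<Sum>b<?N. S c a b * ?D b f)"
    using a by (simp only: sum.delta' finite_lessThan lessThan_iff if_True one)
  finally show ?thesis .
qed

text \<open>The sign \<open>(-1) ^ (0 + 1)\<close> cancels the minus sign of the bracket.\<close>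

lemma hamiltonian_field_even:
  assumes W: "openin (Euclidean_space (edim M)) (crange M c)"
    and f: "has_parity 0 (f c)" and a: "a < edim M + odim M"
  shows "hamiltonian_field M S f c a = (\<Sum>b<edim M + odim M. S c a b * pd (edim M) (crange M c) b (f c))"
proof -
  have p: "part 0 (f c) = f c" "part 1 (f c) = 0"
    using part_same[OF f, of 0] part_other[OF f, of 1] by simp_all
  show ?thesis
    unfolding hamiltonian_field_def sum_lessThan_2 p odd_bracket_zero odd_bracket_coord[OF W f a]
    by simp
qed

text \<open>For even \<open>f\<close> the component \<open>X a\<close> has the parity opposite to
  that of the coordinate \<open>a\<close>. Hence the summand \<open>e = 0\<close> of the divergence
  vanishes, and in the summand \<open>e = 1\<close> the exponent of the sign is even.\<close>

lemma odd_laplacian_even: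
  assumes M: "supermanifold M" and S: "odd_poisson M S" and c: "c \<in> charts M"
    and f: "f \<in> even_chart_families M"
  shows "odd_laplacian M S \<rho> f c =
    (\<lambda>x. inverse (\<rho> c x)) * laplace_expr (edim M) (odim M) (crange M c) (S c) (\<rho> c) (f c)"
proof -
  let ?n = "edim M" and ?N = "edim M + odim M" and ?W = "crange M c"
  interpret odd_poisson_domain ?n "odim M" ?W "S c" by (rule odd_poisson_domain_chart[OF M S c])
  have f0: "has_parity 0 (f c)" using f c by (simp add: even_chart_families_def)
  define X where "X a = (\<Sum>b<?N. S c a b * pd ?n ?W b (f c))" for a
  have X: "hamiltonian_field M S f c a = X a" if "a < ?N" for a
    unfolding X_def by (rule hamiltonian_field_even[of M c f a S, OF W f0 that])
  have "has_parity (par ?n a + 1) (X a)" if a: "a < ?N" for a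
    unfolding X_def
  proof (rule has_parity_sum)
    fix b assume "b \<in> {..<?N}"
    then have "has_parity (par ?n a + par ?n b + 1 + (0 + par ?n b)) (S c a b * pd ?n ?W b (f c))"
      using a by (intro has_parity_mult S_parity has_parity_pd f0) auto
    then show "has_parity (par ?n a + 1) (S c a b * pd ?n ?W b (f c))"
      by (rule has_parity_cong[THEN iffD1, rotated]) auto
  qed
  then have p: "part (par ?n a + 0) (X a) = 0" "part (par ?n a + 1) (X a) = X a" if "a < ?N" for a
    using that part_other part_same by force+
  have "(\<Sum>e<2. \<Sum>a<?N. (-1) ^ (par ?n a * (e + 1)) *
        pd ?n ?W a (\<rho> c * part (par ?n a + e) (hamiltonian_field M S f c a))) =
      (\<Sum>a<?N. pd ?n ?W a (\<rho> c * X a))"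
  proof -
    have "(\<Sum>a<?N. (-1) ^ (par ?n a * (0 + 1)) *
        pd ?n ?W a (\<rho> c * part (par ?n a + 0) (hamiltonian_field M S f c a))) = (\<Sum>a<?N. 0)"
      by (intro sum.cong refl) (simp only: X p lessThan_iff mult_zero_right pd_zero)
    moreover have "(\<Sum>a<?N. (-1) ^ (par ?n a * (1 + 1)) *
        pd ?n ?W a (\<rho> c * part (par ?n a + 1) (hamiltonian_field M S f c a))) =
        (\<Sum>a<?N. pd ?n ?W a (\<rho> c * X a))"
    proof (intro sum.cong refl)
      fix a assume a: "a \<in> {..<?N}"
      have "(-1 :: superfun) ^ (par ?n a * (1 + 1)) = 1" by simp
      then show "(-1) ^ (par ?n a * (1 + 1)) *
          pd ?n ?W a (\<rho> c * part (par ?n a + 1) (hamiltonian_field M S f c a)) = pd ?n ?W a (\<rho> c * X a)"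
        using a by (simp only: X p lessThan_iff mult_1)
    qed
    ultimately show ?thesis unfolding sum_lessThan_2 by (simp only: sum.neutral_const add_0)
  qed
  then show ?thesis
    using c by (simp only: odd_laplacian_def divergence_def Let_def if_True laplace_expr_def X_def)
qed

text \<open>Two-sided inverses are unique, so the description in \<open>inverse\<close> denotes
  \<open>y\<close>.\<close>

lemma inverse_grassmann_cancel:
  fixes x y :: grassmann
  assumes "x * y = 1" "y * x = 1"
  shows "inverse x * x = 1" "x * inverse x = 1"
proof -
  have "z = y" if z: "x * z = 1 \<and> z * x = 1" for z
  proof -
    have "z = z * (x * y)" using assms by simp
    also have "\<dots> = y" using z by (simp flip: mult.assoc)
    finally show ?thesis .
  qed
  then have "(THE y. x * y = 1 \<and> y * x = 1) = y"
    using assms by (intro the_equality conjI)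
  moreover have "\<exists>y. x * y = 1 \<and> y * x = 1" using assms by blast
  ultimately have "inverse x = y" by (simp add: inverse_grassmann_def)
  then show "inverse x * x = 1" "x * inverse x = 1" using assms by simp_all
qed

lemma laplace_expr_outside: "x \<notin> W \<Longrightarrow> laplace_expr n m W S \<rho> f x = 0"
proof -
  assume x: "x \<notin> W"
  have "(\<Sum>a\<in>A. F a) x = (\<Sum>a\<in>A. F a x)" for F :: "nat \<Rightarrow> superfun" and A
    by (induction A rule: infinite_finite_induct) auto
  then show ?thesis using x by (simp add: laplace_expr_def pd_outside)
qed

text \<open>Multiplying by \<rho> removes \<open>inverse (\<rho> c x)\<close> at the points of a
  chart range; elsewhere, and at indices that are not charts, everything is 0 by convention. The
  global equation becomes one free of inverses in each chart.\<close>

lemma odd_laplacian_eq_0_iff: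
  assumes M: "supermanifold M" and S: "odd_poisson M S"
    and \<rho>: "\<rho> \<in> nondegenerate_volume_forms M" and f: "f \<in> even_chart_families M"
  shows "odd_laplacian M S \<rho> f = 0 \<longleftrightarrow>
    (\<forall>c\<in>charts M. laplace_expr (edim M) (odim M) (crange M c) (S c) (\<rho> c) (f c) = 0)"
proof -
  have "odd_laplacian M S \<rho> f c = 0 \<longleftrightarrow>
      laplace_expr (edim M) (odim M) (crange M c) (S c) (\<rho> c) (f c) = 0" (is "_ \<longleftrightarrow> ?L = 0")
    if c: "c \<in> charts M" for c
  proof
    assume 0: "odd_laplacian M S \<rho> f c = 0"
    obtain g where g: "\<rho> c * g = const_fun (crange M c) 1" and even: "has_parity 0 (\<rho> c)"
      using \<rho> c by (auto simp: nondegenerate_volume_forms_def)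
    show "?L = 0"
    proof
      fix x
      show "?L x = 0 x"
      proof (cases "x \<in> crange M c")
        case True
        have "\<rho> c x * g x = 1" using fun_cong[OF g, of x] True by (simp add: const_fun_def)
        \<comment> \<open>Nondegeneracy provides a right inverse only; \<open>\<rho> c x\<close> is
          even, hence central, which makes the inverse two-sided.\<close>
        moreover have "\<rho> c x * g x = g x * \<rho> c x"
          using even ghomog_0_commute by (simp add: has_parity_iff)
        ultimately have inv: "\<rho> c x * inverse (\<rho> c x) = 1"
          using inverse_grassmann_cancel[of "\<rho> c x" "g x"] by simp
        have "inverse (\<rho> c x) * ?L x = 0"
          using fun_cong[OF 0, of x] unfolding odd_laplacian_even[OF M S c f] by simp
        then have "\<rho> c x * inverse (\<rho> c x) * ?L x = 0" by (simp add: mult.assoc)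
        then show ?thesis by (simp add: inv)
      qed (simp add: laplace_expr_outside)
    qed
  qed (simp add: odd_laplacian_even[OF M S c f] fun_eq_iff)
  moreover have "odd_laplacian M S \<rho> f c = 0" if "c \<notin> charts M" for c
    using that by (simp add: odd_laplacian_def divergence_def)
  moreover have "odd_laplacian M S \<rho> f = 0 \<longleftrightarrow> (\<forall>c. odd_laplacian M S \<rho> f c = 0)"
    by (simp add: fun_eq_iff)
  ultimately show ?thesis by blast
qed

section \<open>The master equation and its groupoid\<close>

locale odd_poisson_supermanifold =
  fixes M :: "('p, 'c) supermfd" and S :: "'c tensor"
  assumes M: "supermanifold M" and S: "odd_poisson M S"
begin

abbreviation half_exp :: "'c family \<Rightarrow> 'c family" where
  "half_exp \<sigma> \<equiv> exp_function M (scale_family (1/2) \<sigma>)"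

lemma half_exp_even: "\<sigma> \<in> even_functions M \<Longrightarrow> half_exp \<sigma> \<in> even_chart_families M"
  using even_functions_subset even_chart_families_exp[OF M] even_chart_families_scale[OF M] by blast

lemma half_exp_add:
  "\<sigma> \<in> even_functions M \<Longrightarrow> \<tau> \<in> even_functions M \<Longrightarrow> half_exp (\<sigma> + \<tau>) = half_exp \<sigma> * half_exp \<tau>"
  unfolding scale_family_add
  by (rule exp_function_add[OF M]; rule even_chart_families_scale[OF M];
      rule subsetD[OF even_functions_subset])

text \<open>Brings the target \<open>exp_function M \<sigma> * \<rho>\<close> of an arrow into the
  form \<open>f * (f * \<rho>)\<close> of the gauge identity.\<close>

lemma half_exp_square:
  assumes "\<sigma> \<in> even_functions M"
  shows "half_exp \<sigma> * half_exp \<sigma> = exp_function M \<sigma>"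
proof -
  have "scale_family (1/2) \<sigma> + scale_family (1/2) \<sigma> = \<sigma>"
    by (simp flip: scale_family_add_left)
  moreover have "scale_family (1/2) \<sigma> \<in> even_chart_families M"
    using assms even_functions_subset even_chart_families_scale[OF M] by blast
  ultimately show ?thesis
    using exp_function_add[OF M, of "scale_family (1/2) \<sigma>" "scale_family (1/2) \<sigma>"] by simp
qed

lemma half_exp_inverse:
  assumes \<sigma>: "\<sigma> \<in> even_functions M"
  shows "half_exp (- \<sigma>) * half_exp \<sigma> = one_function M"
  using half_exp_add[OF uminus_even_functions[OF M \<sigma>] \<sigma>]
  by (simp add: exp_function_zero[OF M])

lemma exp_function_uminus:
  assumes \<sigma>: "\<sigma> \<in> even_functions M"
  shows "exp_function M \<sigma> * exp_function M (- \<sigma>) = one_function M"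
    "exp_function M (- \<sigma>) * exp_function M \<sigma> = one_function M"
  using \<sigma> uminus_even_functions[OF M \<sigma>] even_functions_subset
  by (auto intro!: exp_function_inverse[OF M])

lemma laplace_expr_gauge_chart:
  assumes c: "c \<in> charts M" and \<rho>: "\<rho> \<in> nondegenerate_volume_forms M"
    and \<sigma>: "\<sigma> \<in> even_functions M" and \<tau>: "\<tau> \<in> even_functions M"
    and \<rho>': "\<rho>' = exp_function M \<sigma> * \<rho>"
  defines "L \<equiv> laplace_expr (edim M) (odim M) (crange M c) (S c)"
  shows "L (\<rho>' c) (half_exp \<tau> c) =
    half_exp \<sigma> c * (L (\<rho> c) (half_exp (\<sigma> + \<tau>) c) - half_exp \<tau> c * L (\<rho> c) (half_exp \<sigma> c))"
proof -
  interpret odd_poisson_domain "edim M" "odim M" "crange M c" "S c"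
    by (rule odd_poisson_domain_chart[OF M S c])
  have "\<rho>' = half_exp \<sigma> * (half_exp \<sigma> * \<rho>)"
    unfolding \<rho>' half_exp_square[OF \<sigma>, symmetric] by (rule mult.assoc)
  then have \<rho>'_eq: "\<rho>' c = half_exp \<sigma> c * (half_exp \<sigma> c * \<rho> c)" by simp
  have exp_eq: "half_exp (\<sigma> + \<tau>) c = half_exp \<sigma> c * half_exp \<tau> c"
    using half_exp_add[OF \<sigma> \<tau>] by simp
  have "\<rho> \<in> even_chart_families M" using \<rho> nondegenerate_volume_forms_subset by blast
  then show ?thesis
    unfolding L_def \<rho>'_eq exp_eq
    using c half_exp_even[OF \<sigma>] half_exp_even[OF \<tau>]
    by (intro laplace_expr_gauge) (simp_all add: even_chart_families_def)
qed

lemma master_compose: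
  assumes \<rho>: "\<rho> \<in> nondegenerate_volume_forms M" "\<rho>' \<in> nondegenerate_volume_forms M"
    and \<sigma>: "\<sigma> \<in> even_functions M" and \<tau>: "\<tau> \<in> even_functions M"
    and \<rho>': "\<rho>' = exp_function M \<sigma> * \<rho>"
    and 1: "odd_laplacian M S \<rho> (half_exp \<sigma>) = 0" and 2: "odd_laplacian M S \<rho>' (half_exp \<tau>) = 0"
  shows "odd_laplacian M S \<rho> (half_exp (\<sigma> + \<tau>)) = 0"
  unfolding odd_laplacian_eq_0_iff[OF M S \<rho>(1) half_exp_even[OF add_even_functions[OF M \<sigma> \<tau>]]]
proof
  fix c assume c: "c \<in> charts M"
  let ?L = "laplace_expr (edim M) (odim M) (crange M c) (S c)"
  have "?L (\<rho> c) (half_exp \<sigma> c) = 0" "?L (\<rho>' c) (half_exp \<tau> c) = 0"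
    using 1 2 c odd_laplacian_eq_0_iff[OF M S \<rho>(1) half_exp_even[OF \<sigma>]]
      odd_laplacian_eq_0_iff[OF M S \<rho>(2) half_exp_even[OF \<tau>]] by blast+
  then have 0: "half_exp \<sigma> c * ?L (\<rho> c) (half_exp (\<sigma> + \<tau>) c) = 0"
    using laplace_expr_gauge_chart[OF c \<rho>(1) \<sigma> \<tau> \<rho>'] by (simp only: mult_zero_right diff_0_right)
  \<comment> \<open>The factor \<open>half_exp \<sigma> c\<close> is cancelled by multiplying with
    \<open>half_exp (- \<sigma>) c\<close> from the left.\<close>
  have "half_exp (- \<sigma>) c * half_exp \<sigma> c = const_fun (crange M c) 1"
    using fun_cong[OF half_exp_inverse[OF \<sigma>], of c] c by (simp add: one_function_def)
  then have "const_fun (crange M c) 1 * ?L (\<rho> c) (half_exp (\<sigma> + \<tau>) c) =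
      half_exp (- \<sigma>) c * (half_exp \<sigma> c * ?L (\<rho> c) (half_exp (\<sigma> + \<tau>) c))"
    by (simp only: flip: mult.assoc)
  then have "const_fun (crange M c) 1 * ?L (\<rho> c) (half_exp (\<sigma> + \<tau>) c) = 0"
    unfolding 0 by (simp only: mult_zero_right)
  \<comment> \<open>The constant 1 of the chart acts as a unit here, since \<open>?L\<close> gives 0
    outside the chart range.\<close>
  moreover have "const_fun (crange M c) 1 * ?L (\<rho> c) (half_exp (\<sigma> + \<tau>) c) = ?L (\<rho> c) (half_exp (\<sigma> + \<tau>) c)"
  proof
    fix x
    show "(const_fun (crange M c) 1 * ?L (\<rho> c) (half_exp (\<sigma> + \<tau>) c)) x = ?L (\<rho> c) (half_exp (\<sigma> + \<tau>) c) x"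
      by (cases "x \<in> crange M c") (simp_all add: const_fun_def laplace_expr_outside)
  qed
  ultimately show "?L (\<rho> c) (half_exp (\<sigma> + \<tau>) c) = 0" by simp
qed

text \<open>\<open>half_exp 0\<close> is constant in every chart, so its derivatives vanish. This
  yields the identity arrows and, for inverse arrows, the equation for the product of e^(\<sigma>/2)
  and e^(-\<sigma>/2).\<close>

lemma master_zero:
  assumes "\<rho> \<in> nondegenerate_volume_forms M"
  shows "odd_laplacian M S \<rho> (half_exp 0) = 0"
  unfolding odd_laplacian_eq_0_iff[OF M S assms half_exp_even[OF zero_even_function[OF M]]]
  by (simp add: exp_function_zero[OF M] one_function_def laplace_expr_const[OF openin_crange[OF M]])

lemma master_inverse:
  assumes \<rho>: "\<rho> \<in> nondegenerate_volume_forms M" "\<rho>' \<in> nondegenerate_volume_forms M"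
    and \<sigma>: "\<sigma> \<in> even_functions M"
    and \<rho>': "\<rho>' = exp_function M \<sigma> * \<rho>" and 1: "odd_laplacian M S \<rho> (half_exp \<sigma>) = 0"
  shows "odd_laplacian M S \<rho>' (half_exp (- \<sigma>)) = 0"
  unfolding odd_laplacian_eq_0_iff[OF M S \<rho>(2) half_exp_even[OF uminus_even_functions[OF M \<sigma>]]]
proof
  fix c assume c: "c \<in> charts M"
  let ?L = "laplace_expr (edim M) (odim M) (crange M c) (S c)"
  have 1: "?L (\<rho> c) (half_exp \<sigma> c) = 0"
    using 1 c odd_laplacian_eq_0_iff[OF M S \<rho>(1) half_exp_even[OF \<sigma>]] by blast
  have 2: "?L (\<rho> c) (half_exp (\<sigma> + - \<sigma>) c) = 0"
    using c master_zero[OF \<rho>(1)]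
      odd_laplacian_eq_0_iff[OF M S \<rho>(1) half_exp_even[OF zero_even_function[OF M]]]
    by (simp only: add.right_inverse)
  show "?L (\<rho>' c) (half_exp (- \<sigma>) c) = 0"
    unfolding laplace_expr_gauge_chart[OF c \<rho>(1) \<sigma> uminus_even_functions[OF M \<sigma>] \<rho>'] 1 2
    by (simp only: mult_zero_right diff_0_right)
qed

lemma master_arrowE:
  assumes "f \<in> master_arrows M S"
  obtains \<rho> \<sigma> \<rho>' where "f = (\<rho>, exp_function M \<sigma>, \<rho>')"
    "\<rho> \<in> nondegenerate_volume_forms M" "\<rho>' \<in> nondegenerate_volume_forms M"
    "\<sigma> \<in> even_functions M" "\<rho>' = exp_function M \<sigma> * \<rho>" "odd_laplacian M S \<rho> (half_exp \<sigma>) = 0"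
  using assms unfolding master_arrows_def by blast

lemma master_arrowI:
  assumes "\<rho> \<in> nondegenerate_volume_forms M" "\<rho>' \<in> nondegenerate_volume_forms M"
    "\<sigma> \<in> even_functions M" "\<rho>' = exp_function M \<sigma> * \<rho>" "odd_laplacian M S \<rho> (half_exp \<sigma>) = 0"
  shows "(\<rho>, exp_function M \<sigma>, \<rho>') \<in> master_arrows M S"
  using assms unfolding master_arrows_def by blast

lemma groupoid_master_arrows:
  "groupoid (nondegenerate_volume_forms M) (master_arrows M S)
     arrow_source arrow_target (identity_arrow M) compose_arrows"
  unfolding groupoid_def
proof (intro conjI ballI impI)
  fix f assume "f \<in> master_arrows M S"
  then obtain \<rho> \<sigma> \<rho>' where f: "f = (\<rho>, exp_function M \<sigma>, \<rho>')"
    "\<rho> \<in> nondegenerate_volume_forms M" "\<rho>' \<in> nondegenerate_volume_forms M"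
    "\<sigma> \<in> even_functions M" "\<rho>' = exp_function M \<sigma> * \<rho>" "odd_laplacian M S \<rho> (half_exp \<sigma>) = 0"
    by (rule master_arrowE)
  show "arrow_source f \<in> nondegenerate_volume_forms M" "arrow_target f \<in> nondegenerate_volume_forms M"
    using f by (simp_all add: arrow_source_def arrow_target_def)
  have "\<sigma> \<in> even_chart_families M" "0 \<in> even_chart_families M"
    using f(4) zero_even_function[OF M] even_functions_subset by blast+
  \<comment> \<open>The unit law is known on the left; commuting with
    \<open>exp_function M 0\<close> gives it on the right.\<close>
  then have "exp_function M \<sigma> * one_function M = exp_function M \<sigma>"
    using exp_function_mult_commute[OF M, of \<sigma> 0]
    by (simp only: exp_function_zero[OF M] one_function_mult_exp[OF M])
  then show "compose_arrows (identity_arrow M (arrow_source f)) f = f"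
    "compose_arrows f (identity_arrow M (arrow_target f)) = f"
    by (simp_all add: f(1) compose_arrows_def identity_arrow_def arrow_source_def arrow_target_def
        one_function_mult_exp[OF M])
  \<comment> \<open>The inverse arrow must end at \<rho> itself, so the product of the two
    exponentials, which is \<open>one_function M\<close>, has to act on volume forms as a
    unit.\<close>
  have "\<rho> = exp_function M (- \<sigma>) * \<rho>'"
    unfolding f(5) mult.assoc[symmetric] exp_function_uminus[OF f(4)]
    by (rule one_function_mult_volume[OF M f(2), symmetric])
  then have "(\<rho>', exp_function M (- \<sigma>), \<rho>) \<in> master_arrows M S"
    by (rule master_arrowI[OF f(3,2) uminus_even_functions[OF M f(4)] _ master_inverse[OF f(2-6)]])
  then show "\<exists>g\<in>master_arrows M S. arrow_source g = arrow_target f \<and> arrow_target g = arrow_source f \<and>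
      compose_arrows f g = identity_arrow M (arrow_source f) \<and>
      compose_arrows g f = identity_arrow M (arrow_target f)"
    by (rule rev_bexI) (simp add: f(1) compose_arrows_def identity_arrow_def arrow_source_def
        arrow_target_def exp_function_uminus[OF f(4)])
next
  fix \<rho> assume \<rho>: "\<rho> \<in> nondegenerate_volume_forms M"
  have "(\<rho>, exp_function M 0, \<rho>) \<in> master_arrows M S"
    by (rule master_arrowI[OF \<rho> \<rho> zero_even_function[OF M] _ master_zero[OF \<rho>]])
      (simp only: exp_function_zero[OF M] one_function_mult_volume[OF M \<rho>])
  then show "identity_arrow M \<rho> \<in> master_arrows M S"
    by (simp add: identity_arrow_def exp_function_zero[OF M])
  show "arrow_source (identity_arrow M \<rho>) = \<rho>" "arrow_target (identity_arrow M \<rho>) = \<rho>"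
    by (simp_all add: identity_arrow_def arrow_source_def arrow_target_def)
next
  fix f g assume f: "f \<in> master_arrows M S" and g: "g \<in> master_arrows M S"
    and fg: "arrow_target f = arrow_source g"
  obtain \<rho> \<sigma> \<rho>' where f: "f = (\<rho>, exp_function M \<sigma>, \<rho>')"
    "\<rho> \<in> nondegenerate_volume_forms M" "\<rho>' \<in> nondegenerate_volume_forms M"
    "\<sigma> \<in> even_functions M" "\<rho>' = exp_function M \<sigma> * \<rho>" "odd_laplacian M S \<rho> (half_exp \<sigma>) = 0"
    using f by (rule master_arrowE)
  obtain \<rho>1 \<tau> \<rho>'' where g': "g = (\<rho>1, exp_function M \<tau>, \<rho>'')"
    "\<rho>1 \<in> nondegenerate_volume_forms M" "\<rho>'' \<in> nondegenerate_volume_forms M"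
    "\<tau> \<in> even_functions M" "\<rho>'' = exp_function M \<tau> * \<rho>1" "odd_laplacian M S \<rho>1 (half_exp \<tau>) = 0"
    using g by (rule master_arrowE)
  have "\<rho>1 = \<rho>'" using fg by (simp add: f(1) g'(1) arrow_source_def arrow_target_def)
  note g = g'[unfolded this]
  have ev: "\<sigma> \<in> even_chart_families M" "\<tau> \<in> even_chart_families M"
    using f(4) g(4) even_functions_subset by auto
  have exp: "exp_function M (\<sigma> + \<tau>) = exp_function M \<sigma> * exp_function M \<tau>"
    by (rule exp_function_add[OF M ev])
  \<comment> \<open>Substitution puts the exponential of \<tau> before that of \<sigma>, composition
    the other way round; exponentials of even functions commute.\<close>
  have "\<rho>'' = exp_function M (\<sigma> + \<tau>) * \<rho>"
    unfolding exp exp_function_mult_commute[OF M ev] g(5) f(5) by (rule mult.assoc[symmetric])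
  then have "(\<rho>, exp_function M (\<sigma> + \<tau>), \<rho>'') \<in> master_arrows M S"
    by (rule master_arrowI[OF f(2) g(3) add_even_functions[OF M f(4) g(4)] _
          master_compose[OF f(2,3,4) g(4) f(5,6) g(6)]])
  then show "compose_arrows f g \<in> master_arrows M S"
    by (simp add: f(1) g(1) compose_arrows_def exp)
  show "arrow_source (compose_arrows f g) = arrow_source f"
    "arrow_target (compose_arrows f g) = arrow_target g"
    by (simp_all add: f(1) g(1) compose_arrows_def arrow_source_def arrow_target_def)
next
  fix f g h :: "'c arrow"
  show "compose_arrows (compose_arrows f g) h = compose_arrows f (compose_arrows g h)"
    by (cases f; cases g; cases h) (simp add: compose_arrows_def mult.assoc)
qed

end

theorem theorem2p2:
  fixes M :: "('p, 'c) supermfd" and S :: "'c tensor"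
  assumes "supermanifold M" and "odd_poisson M S"
  shows "groupoid (nondegenerate_volume_forms M) (master_arrows M S)
           arrow_source arrow_target (identity_arrow M) compose_arrows \<and>
         (\<forall>\<rho> \<rho>' \<rho>'' \<sigma> \<tau>.
            \<rho> \<in> nondegenerate_volume_forms M \<and> \<rho>' \<in> nondegenerate_volume_forms M \<and>
            \<rho>'' \<in> nondegenerate_volume_forms M \<and>
            \<sigma> \<in> even_functions M \<and> \<tau> \<in> even_functions M \<and>
            \<rho>' = exp_function M \<sigma> * \<rho> \<and> \<rho>'' = exp_function M \<tau> * \<rho>' \<and>
            odd_laplacian M S \<rho> (exp_function M (scale_family (1/2) \<sigma>)) = 0 \<and>
            odd_laplacian M S \<rho>' (exp_function M (scale_family (1/2) \<tau>)) = 0 \<longrightarrow>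
            odd_laplacian M S \<rho> (exp_function M (scale_family (1/2) (\<sigma> + \<tau>))) = 0) \<and>
         (\<forall>\<rho> \<rho>' \<sigma>.
            \<rho> \<in> nondegenerate_volume_forms M \<and> \<rho>' \<in> nondegenerate_volume_forms M \<and>
            \<sigma> \<in> even_functions M \<and> \<rho>' = exp_function M \<sigma> * \<rho> \<and>
            odd_laplacian M S \<rho> (exp_function M (scale_family (1/2) \<sigma>)) = 0 \<longrightarrow>
            odd_laplacian M S \<rho>' (exp_function M (scale_family (- (1/2)) \<sigma>)) = 0)"
proof -
  interpret odd_poisson_supermanifold M S by standard (fact assms)+
  have "odd_laplacian M S \<rho>' (exp_function M (scale_family (- (1/2)) \<sigma>)) = 0"
    if "\<rho> \<in> nondegenerate_volume_forms M" "\<rho>' \<in> nondegenerate_volume_forms M"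
      "\<sigma> \<in> even_functions M" "\<rho>' = exp_function M \<sigma> * \<rho>"
      "odd_laplacian M S \<rho> (exp_function M (scale_family (1/2) \<sigma>)) = 0" for \<rho> \<rho>' \<sigma>
    \<comment> \<open>The inverse law is proved for \<open>- \<sigma>\<close> scaled by 1/2, while
      the claim scales \<sigma> by -1/2.\<close>
    using master_inverse[OF that] by (simp only: scale_family_uminus)
  then show ?thesis
    using groupoid_master_arrows master_compose by blast
qed

end
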